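(* Let $f\in\mathrm{TotP}$ and let $M_f$ be a binary nondeterministic polynomial-time Turing machine witnessing this, i.e. for every input $x$ the total number of computation paths of $M_f$ on $x$ equals $f(x)+1$. For an input $x\in\{0,1\}^n$ let $n'$ be the number of nondeterministic bits used by $M_f$ on $x$. Then there is a randomized algorithm which, for every $\xi>0$ and every $x\in\{0,1\}^n$, outputs with high probability (i.e. with probability at least $1-\delta$ for any prescribed constant $\delta\in(0,1)$), in time $O(\xi^{-2}\cdot \mathrm{poly}(n))$, an estimate $\hat f(x)$ with $f(x)-\xi\cdot 2^{n'}\le \hat f(x)\le f(x)+\xi\cdot 2^{n'}$. Equivalently, for $p=f(x)/2^{n'}$ it outputs $\hat p$ with $p-\xi\le\hat p\le p+\xi$.
   Context: $\mathrm{TotP}$ is the class of functions $f:\{0,1\}^*\to\mathbb{N}$ for which there is a nondeterministic polynomial-time Turing machine (NPTM) $M$ such that for every input $x$ the number of all computation paths of $M$ on $x$ (accepting or not) equals $f(x)+1$. Such an $M$ can always be chosen binary: at each nondeterministic step it has exactly two choices; then the computation tree of $M$ on $x$ is a binary tree with exactly $f(x)$ internal nodes (branchings). The number of nondeterministic bits used on $x$ is the height of this computation tree (the maximum number of nondeterministic choices along a path).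
   Formalization: The running time is bounded by max(1, ξ^{-2})·poly(n) instead of ξ^{-2}·poly(n); this differs only for ξ > 1, where the literal bound would fall below a single step for large ξ and could not hold. *)

theory Defs
  imports "HOL-Probability.Probability" "HOL-Computational_Algebra.Polynomial"
begin

text \<open>
  Nondeterministic multi-tape Turing machines with two-way infinite tapes. States and tape
  symbols are initial segments of the naturals; state 0 is the start state, and symbols 0, 1, 2
  are the blank and the bits 0 and 1. The transition function returns the list of all choices
  available; the machine halts exactly when this list is empty.
\<close>

datatype move = MoveL | Stay | MoveR

primrec shift :: "move \<Rightarrow> int" where
  "shift MoveL = -1"
| "shift Stay = 0"
| "shift MoveR = 1"

text \<open>A tape is its contents together with the position of the head.\<close>

type_synonym tape = "(int \<Rightarrow> nat) \<times> int"
type_synonym config = "nat \<times> tape list"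
type_synonym action = "nat \<times> (nat \<times> move) list"

record machine =
  num_tapes :: nat
  num_states :: nat
  num_syms :: nat
  trans :: "nat \<Rightarrow> nat list \<Rightarrow> action list"

definition wf_machine :: "machine \<Rightarrow> bool" where
  "wf_machine M \<longleftrightarrow> 1 \<le> num_tapes M \<and> 1 \<le> num_states M \<and> 3 \<le> num_syms M \<and>
     (\<forall>q ss. q < num_states M \<and> length ss = num_tapes M \<and> set ss \<subseteq> {..<num_syms M} \<longrightarrow>
        (\<forall>(q', ws) \<in> set (trans M q ss). q' < num_states M \<and> length ws = num_tapes M \<and>
           (\<forall>(s, d) \<in> set ws. s < num_syms M)))"

definition binary_machine :: "machine \<Rightarrow> bool" where
  "binary_machine M \<longleftrightarrow> (\<forall>q ss. q < num_states M \<and> length ss = num_tapes M \<and> set ss \<subseteq> {..<num_syms M} \<longrightarrow>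
     length (trans M q ss) \<le> 2)"

definition scan :: "tape \<Rightarrow> nat" where
  "scan t = fst t (snd t)"

definition write_move :: "nat \<times> move \<Rightarrow> tape \<Rightarrow> tape" where
  "write_move w t = ((fst t)(snd t := fst w), snd t + shift (snd w))"

definition perform :: "action \<Rightarrow> config \<Rightarrow> config" where
  "perform a c = (fst a, map2 write_move (snd a) (snd c))"

definition succs :: "machine \<Rightarrow> config \<Rightarrow> config list" where
  "succs M c = map (\<lambda>a. perform a c) (trans M (fst c) (map scan (snd c)))"

text \<open>
  A partial run is described by the list of indices of the choices taken, one for each step
  (always 0 at a deterministic step).
\<close>

fun follow :: "machine \<Rightarrow> config \<Rightarrow> nat list \<Rightarrow> config option" where
  "follow M c [] = Some c"
| "follow M c (k # ks) =
     (if k < length (succs M c) then follow M (succs M c ! k) ks else None)"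

definition computation_paths :: "machine \<Rightarrow> config \<Rightarrow> nat list set" where
  "computation_paths M c = {ks. \<exists>c'. follow M c ks = Some c' \<and> succs M c' = []}"

fun branchings :: "machine \<Rightarrow> config \<Rightarrow> nat list \<Rightarrow> nat" where
  "branchings M c [] = 0"
| "branchings M c (k # ks) =
     (if 2 \<le> length (succs M c) then 1 else 0) + branchings M (succs M c ! k) ks"

definition halts_within :: "machine \<Rightarrow> config \<Rightarrow> nat \<Rightarrow> bool" where
  "halts_within M c t \<longleftrightarrow> (\<forall>ks. follow M c ks \<noteq> None \<longrightarrow> length ks \<le> t)"

definition bit_sym :: "bool \<Rightarrow> nat" where
  "bit_sym b = (if b then 2 else 1)"

definition blank_tape :: tape where
  "blank_tape = (\<lambda>_. 0, 0)"

definition string_tape :: "bool list \<Rightarrow> tape" where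
  "string_tape x = (\<lambda>i. if 0 \<le> i \<and> i < int (length x) then bit_sym (x ! nat i) else 0, 0)"

definition initial :: "machine \<Rightarrow> tape list \<Rightarrow> config" where
  "initial M ts = (0, ts @ replicate (num_tapes M - length ts) blank_tape)"

definition start :: "machine \<Rightarrow> bool list \<Rightarrow> config" where
  "start M x = initial M [string_tape x]"

definition nptm :: "machine \<Rightarrow> bool" where
  "nptm M \<longleftrightarrow> wf_machine M \<and>
     (\<exists>q :: nat poly. \<forall>x. halts_within M (start M x) (poly q (length x)))"

definition TotP_witness :: "machine \<Rightarrow> (bool list \<Rightarrow> nat) \<Rightarrow> bool" where
  "TotP_witness M f \<longleftrightarrow> nptm M \<and> (\<forall>x. card (computation_paths M (start M x)) = f x + 1)"

definition TotP :: "(bool list \<Rightarrow> nat) set" where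
  "TotP = {f. \<exists>M. TotP_witness M f}"

definition nondet_bits :: "machine \<Rightarrow> bool list \<Rightarrow> nat" where
  "nondet_bits M x = Max (branchings M (start M x) ` computation_paths M (start M x))"

text \<open>
  Randomized algorithms are the same machines with every choice made uniformly at random; for a
  binary machine, every step is deterministic or tosses one fair coin.
\<close>

primrec run_pmf :: "machine \<Rightarrow> nat \<Rightarrow> config \<Rightarrow> config pmf" where
  "run_pmf M 0 c = return_pmf c"
| "run_pmf M (Suc t) c =
     (if succs M c = [] then return_pmf c
      else bind_pmf (pmf_of_set {..<length (succs M c)}) (\<lambda>k. run_pmf M t (succs M c ! k)))"

text \<open>
  A positive real is written on a tape by its full binary expansion, cell \<open>i\<close> holding the digit
  of weight \<open>2\<^sup>-\<^sup>i\<close>: the head starts on the units digit, the fractional digits extend infinitely to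
  the right, and the cells to the left of the leading digit of the integer part are blank.
\<close>

definition real_tape :: "real \<Rightarrow> tape" where
  "real_tape r =
     (\<lambda>i. if i < 0 \<and> r < 2 powi (- i) then 0 else bit_sym (odd \<lfloor>r * 2 powi i\<rfloor>), 0)"

text \<open>
  The same positional convention read backwards; any symbol other than the bit 1 counts as the
  digit 0. In a halting run only finitely many cells are written, so the sum is finite.
\<close>

definition tape_value :: "tape \<Rightarrow> real" where
  "tape_value t = (\<Sum>i | fst t i = bit_sym True. 2 powi (- i))"

text \<open>Inputs on tapes 0 and 1, output on tape 2, all further tapes are work tapes.\<close>

definition randomized_algorithm :: "machine \<Rightarrow> bool" where
  "randomized_algorithm A \<longleftrightarrow> wf_machine A \<and> binary_machine A \<and> 3 \<le> num_tapes A"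

definition start_rand :: "machine \<Rightarrow> bool list \<Rightarrow> real \<Rightarrow> config" where
  "start_rand A x r = initial A [string_tape x, real_tape r]"

definition estimate :: "config \<Rightarrow> real" where
  "estimate c = tape_value (snd c ! 2)"

end

theory Submission
  imports Defs
begin

text \<open>
  Descend the computation tree of \<open>M\<close> by fair coins and score a leaf behind \<open>d\<close> branchings by
  \<open>2 ^ d\<close>, but the leftmost leaf by 0. The expected score is the number of leaves other than the
  leftmost one, i.e. \<open>f x\<close>, and all scores lie between 0 and \<open>N = 2 ^ nondet_bits M x\<close>, although
  \<open>N\<close> itself is never computed. By Chebyshev's inequality, the mean of \<open>2 ^ L\<close> scores is within
  \<open>\<xi> * N\<close> of \<open>f x\<close> except with probability \<open>1 / (2 ^ L * \<xi>\<^sup>2)\<close>; if the leading digit of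
  \<open>\<xi> < 1\<close> has weight \<open>2 ^ (- m)\<close>, it suffices to take \<open>L = 2 * m\<close> plus a constant depending on \<open>\<delta>\<close>.

  The machine adds the scores up on the output tape with the units digit in cell \<open>L\<close>, so that
  division by \<open>2 ^ L\<close> is free, and counts samples in binary on another tape. A single carry may run
  through about \<open>log (1 / \<xi>)\<close> cells; to avoid this factor in the running time, carries are charged to
  the number of ones on the two tapes, which each sample increases by at most two.
\<close>

text \<open>There is one path more than \<open>f x\<close>; giving one leaf the score 0 makes the
  score unbiased for \<open>f x\<close> without a subtraction on the tape, and one bit of control
  state recognises the leftmost leaf. The time allowed per sample is polynomial in the length of
  \<open>x\<close>, whereas \<open>log (1 / \<xi>)\<close> is not bounded in terms of
  \<open>x\<close>. Likewise the tapes of \<open>M\<close> must be blank before each sample, and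
  erasing them may cost only what the run itself cost; therefore the heads are not taken back to the
  origin, and a simulation is correct up to a translation of each tape. As \<open>\<xi>\<close> is
  an arbitrary real, only the position of its leading digit is read; this costs at most a factor 4
  in the number of samples. For \<open>\<xi>\<close> at least 1 the answer 0 is admissible, because
  \<open>f x\<close> lies between 0 and \<open>N\<close>. Runs are analysed backwards from halting:
  the lemma for a phase assumes a time bound and an output distribution for all that follows,
  quantified over data such as head positions that later phases may ignore.\<close>

lemma halts_within_halted: "succs A c = [] \<Longrightarrow> halts_within A c T"
  unfolding halts_within_def
proof (intro allI impI)
  fix ks assume "succs A c = []" "follow A c ks \<noteq> None"
  then show "length ks \<le> T" by (cases ks) auto
qed

lemma halts_within_SucI:
  assumes "\<And>k. k < length (succs A c) \<Longrightarrow> halts_within A (succs A c ! k) T"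
  shows "halts_within A c (Suc T)"
  unfolding halts_within_def
proof (intro allI impI)
  fix ks assume *: "follow A c ks \<noteq> None"
  show "length ks \<le> Suc T"
  proof (cases ks)
    case (Cons k ks')
    with * have "k < length (succs A c)" "follow A (succs A c ! k) ks' \<noteq> None"
      by (auto split: if_splits)
    with assms have "length ks' \<le> T" unfolding halts_within_def by blast
    with Cons show ?thesis by simp
  qed simp
qed

lemma halts_within_succ:
  assumes "halts_within A c (Suc T)" "k < length (succs A c)"
  shows "halts_within A (succs A c ! k) T"
  unfolding halts_within_def
proof (intro allI impI)
  fix ks assume "follow A (succs A c ! k) ks \<noteq> None"
  with assms have "follow A c (k # ks) \<noteq> None" by simp
  with assms(1) have "length (k # ks) \<le> Suc T" unfolding halts_within_def by blast
  then show "length ks \<le> T" by simp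
qed

lemma halts_within_0: "halts_within A c 0 \<Longrightarrow> succs A c = []"
proof (rule ccontr)
  assume h: "halts_within A c 0" and "succs A c \<noteq> []"
  then have "follow A c [0] \<noteq> None" by simp
  with h have "length [0::nat] \<le> 0" unfolding halts_within_def by blast
  then show False by simp
qed

lemma halts_within_mono: "halts_within A c T \<Longrightarrow> T \<le> T' \<Longrightarrow> halts_within A c T'"
  unfolding halts_within_def by (meson le_trans)

lemma run_pmf_halted: "succs A c = [] \<Longrightarrow> run_pmf A T c = return_pmf c"
  by (cases T) auto

lemma run_pmf_extend: "halts_within A c T \<Longrightarrow> run_pmf A (T + k) c = run_pmf A T c"
proof (induction T arbitrary: c)
  case 0
  then show ?case by (simp add: run_pmf_halted halts_within_0)
next
  case (Suc T)
  show ?case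
  proof (cases "succs A c = []")
    case False
    then have "set_pmf (pmf_of_set {..<length (succs A c)}) = {..<length (succs A c)}"
      by (subst set_pmf_of_set) auto
    then show ?thesis
      using False Suc.IH[OF halts_within_succ[OF Suc.prems]] by (auto intro!: bind_pmf_cong)
  qed (simp add: run_pmf_halted)
qed

text \<open>Time bound and output law travel together, so that runs can be composed backwards. Only
  the value of the output tape is recorded, since heads and work tapes of the final configuration
  depend on the random run.\<close>

definition estimates :: "machine \<Rightarrow> config \<Rightarrow> nat \<Rightarrow> real pmf \<Rightarrow> bool" where
  "estimates A c T D \<longleftrightarrow> halts_within A c T \<and> map_pmf estimate (run_pmf A T c) = D"

text \<open>A halted configuration is a fixed point of \<open>run_pmf\<close>, so time bounds may be
  rounded up. This lets random branches of different lengths share one bound.\<close>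

lemma estimates_mono: "estimates A c T D \<Longrightarrow> T \<le> T' \<Longrightarrow> estimates A c T' D"
  unfolding estimates_def using run_pmf_extend[of A c T "T' - T"] halts_within_mono[of A c T T'] by auto

lemma estimates_halted: "succs A c = [] \<Longrightarrow> estimates A c T (return_pmf (estimate c))"
  by (simp add: estimates_def halts_within_halted run_pmf_halted)

lemma estimates_step:
  assumes "succs A c = [c']" "estimates A c' T D"
  shows "estimates A c (Suc T) D"
proof -
  have "halts_within A c (Suc T)"
    using assms by (intro halts_within_SucI) (simp add: estimates_def)
  moreover have "{..<Suc 0} = {0::nat}" by auto
  ultimately show ?thesis
    using assms unfolding estimates_def by (simp add: pmf_of_set_singleton bind_return_pmf)
qed

lemma estimates_coin:
  assumes "succs A c = [c0, c1]" "estimates A c0 T (D 0)" "estimates A c1 T (D 1)"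
  shows "estimates A c (Suc T) (bind_pmf (pmf_of_set {..<2::nat}) D)"
proof -
  have s: "set_pmf (pmf_of_set {..<2::nat}) = {0, 1}"
    by (subst set_pmf_of_set) (auto simp: less_2_cases_iff lessThan_def)
  have l: "length (succs A c) = 2" "succs A c \<noteq> []" using assms(1) by simp_all
  have e: "map_pmf estimate (run_pmf A T (succs A c ! k)) = D k"
    if "k \<in> set_pmf (pmf_of_set {..<2})" for k
    using that assms unfolding s estimates_def by (elim insertE) simp_all
  have "map_pmf estimate (run_pmf A (Suc T) c) = bind_pmf (pmf_of_set {..<2}) D"
    by (simp only: run_pmf.simps(2) l if_False map_bind_pmf) (rule bind_pmf_cong[OF refl e])
  moreover have "halts_within A (succs A c ! k) T" if "k < length (succs A c)" for k
    using that assms unfolding l less_2_cases_iff by (elim disjE) (simp_all add: estimates_def)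
  then have "halts_within A c (Suc T)" by (rule halts_within_SucI)
  ultimately show ?thesis unfolding estimates_def by blast
qed

text \<open>\<open>wf_machine\<close> and \<open>binary_machine\<close> constrain
  \<open>trans\<close> only on states, arities and symbols in range; this invariant keeps a run
  inside that range.\<close>

definition valid_config :: "machine \<Rightarrow> config \<Rightarrow> bool" where
  "valid_config M c \<longleftrightarrow> fst c < num_states M \<and> length (snd c) = num_tapes M \<and>
     (\<forall>t \<in> set (snd c). \<forall>i. fst t i < num_syms M)"

lemma valid_scan:
  "valid_config M c \<Longrightarrow> set (map scan (snd c)) \<subseteq> {..<num_syms M}"
  by (auto simp: valid_config_def scan_def)

lemma valid_trans:
  assumes "wf_machine M" "valid_config M c" "(q', ws) \<in> set (trans M (fst c) (map scan (snd c)))"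
  shows "q' < num_states M" "length ws = num_tapes M" "\<forall>(s, d) \<in> set ws. s < num_syms M"
proof -
  have "fst c < num_states M \<and> length (map scan (snd c)) = num_tapes M \<and>
      set (map scan (snd c)) \<subseteq> {..<num_syms M}"
    using assms(2) valid_scan[OF assms(2)] by (simp add: valid_config_def)
  with assms(1) have "\<forall>(q', ws) \<in> set (trans M (fst c) (map scan (snd c))).
      q' < num_states M \<and> length ws = num_tapes M \<and> (\<forall>(s, d) \<in> set ws. s < num_syms M)"
    unfolding wf_machine_def by blast
  with assms(3) show "q' < num_states M" "length ws = num_tapes M" "\<forall>(s, d) \<in> set ws. s < num_syms M"
    by auto
qed

lemma valid_succs:
  assumes "wf_machine M" "valid_config M c" "c' \<in> set (succs M c)"
  shows "valid_config M c'"
proof -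
  from assms(3) obtain q' ws where a: "(q', ws) \<in> set (trans M (fst c) (map scan (snd c)))"
    and c': "c' = perform (q', ws) c" by (auto simp: succs_def)
  note v = valid_trans[OF assms(1,2) a]
  have "fst (write_move w t) i < num_syms M" if "(w, t) \<in> set (zip ws (snd c))" for w t i
  proof -
    from that have "w \<in> set ws" "t \<in> set (snd c)" by (auto dest: set_zip_leftD set_zip_rightD)
    with v(3) assms(2) show ?thesis by (auto simp: write_move_def valid_config_def)
  qed
  with v assms(2) show ?thesis
    unfolding c' perform_def valid_config_def by auto
qed

lemma length_succs_binary:
  assumes "binary_machine M" "valid_config M c"
  shows "length (succs M c) \<le> 2"
proof -
  have "fst c < num_states M \<and> length (map scan (snd c)) = num_tapes M \<and>
      set (map scan (snd c)) \<subseteq> {..<num_syms M}"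
    using assms(2) valid_scan[OF assms(2)] by (simp add: valid_config_def)
  with assms(1) show ?thesis unfolding binary_machine_def succs_def length_map[of "\<lambda>a. perform a c"] by blast
qed

lemma valid_start:
  assumes "wf_machine M" shows "valid_config M (start M x)"
proof -
  have "fst t i < num_syms M" if "t = string_tape x \<or> t = blank_tape" for t i
    using that assms by (auto simp: wf_machine_def string_tape_def blank_tape_def bit_sym_def)
  with assms show ?thesis
    by (simp add: valid_config_def start_def initial_def wf_machine_def)
qed

subsection \<open>Random descents and their sums\<close>

text \<open>The flag \<open>b\<close> records that the leftmost path has been left.\<close>

primrec descent :: "machine \<Rightarrow> nat \<Rightarrow> nat \<Rightarrow> bool \<Rightarrow> config \<Rightarrow> real pmf" where
  "descent M 0 d b c = return_pmf (if b then 2 ^ d else 0)"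
| "descent M (Suc t) d b c =
     (case succs M c of
        [] \<Rightarrow> return_pmf (if b then 2 ^ d else 0)
      | [c'] \<Rightarrow> descent M t d b c'
      | _ \<Rightarrow> bind_pmf (pmf_of_set {..<2})
               (\<lambda>k. descent M t (Suc d) (b \<or> k = 1) (succs M c ! k)))"

lemma computation_paths_halted: "succs M c = [] \<Longrightarrow> computation_paths M c = {[]}"
proof -
  assume h: "succs M c = []"
  have "ks = []" if "follow M c ks = Some c'" for ks c' using that h by (cases ks) auto
  moreover have "follow M c [] = Some c" by simp
  ultimately show ?thesis unfolding computation_paths_def using h by blast
qed

lemma computation_paths_step:
  assumes "succs M c \<noteq> []"
  shows "computation_paths M c =
    (\<Union>k<length (succs M c). (#) k ` computation_paths M (succs M c ! k))"
proof (intro set_eqI iffI)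
  fix ks assume "ks \<in> computation_paths M c"
  with assms show "ks \<in> (\<Union>k<length (succs M c). (#) k ` computation_paths M (succs M c ! k))"
    by (cases ks) (auto simp: computation_paths_def split: if_splits)
qed (auto simp: computation_paths_def)

lemma finite_computation_paths:
  "halts_within M c t \<Longrightarrow> finite (computation_paths M c)"
proof (induction t arbitrary: c)
  case 0
  then show ?case by (simp add: computation_paths_halted halts_within_0)
next
  case (Suc t)
  show ?case
  proof (cases "succs M c = []")
    case False
    then show ?thesis
      using Suc.IH[OF halts_within_succ[OF Suc.prems]] by (simp add: computation_paths_step)
  qed (simp add: computation_paths_halted)
qed

lemma card_computation_paths_one:
  assumes "succs M c = [c']"
  shows "card (computation_paths M c) = card (computation_paths M c')"
  using assms by (simp add: computation_paths_step lessThan_Suc card_image)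

lemma card_computation_paths_two:
  assumes "succs M c = [c0, c1]" "finite (computation_paths M c0)" "finite (computation_paths M c1)"
  shows "card (computation_paths M c) = card (computation_paths M c0) + card (computation_paths M c1)"
proof -
  have "computation_paths M c = (#) 0 ` computation_paths M c0 \<union> (#) 1 ` computation_paths M c1"
    using assms(1) by (subst computation_paths_step) (auto simp: less_2_cases_iff less_Suc_eq)
  moreover have "(#) 0 ` computation_paths M c0 \<inter> (#) (1::nat) ` computation_paths M c1 = {}" by auto
  ultimately show ?thesis
    using assms by (simp add: card_image card_Un_disjoint)
qed

lemma finite_set_descent: "finite (set_pmf (descent M t d b c))"
proof (induction t arbitrary: d b c)
  case (Suc t)
  have "finite (set_pmf (pmf_of_set {..<2::nat}))" by (subst set_pmf_of_set) (auto simp: lessThan_empty_iff)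
  with Suc show ?case by (simp split: list.split)
qed simp

lemma length_le_2_cases:
  assumes "length xs \<le> 2"
  obtains "xs = []" | a where "xs = [a]" | a b where "xs = [a, b]"
proof (cases xs)
  case Nil then show ?thesis using that by blast
next
  case (Cons a ys)
  then show ?thesis using assms that by (cases ys) auto
qed

text \<open>A leaf behind \<open>e\<close> further branchings is reached with probability
  \<open>2 ^ (- e)\<close> and scores \<open>2 ^ (d + e)\<close>, so every scored leaf contributes
  exactly \<open>2 ^ d\<close>. In the induction, averaging over the coin cancels the doubling
  caused by \<open>Suc d\<close>. Only the left child inherits \<open>b\<close>, hence exactly one
  leaf is lost when \<open>b\<close> is false.\<close>

lemma expectation_descent:
  assumes "wf_machine M" "binary_machine M" "halts_within M c t" "valid_config M c"
  shows "measure_pmf.expectation (descent M t d b c) (\<lambda>v. v) =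
    2 ^ d * (real (card (computation_paths M c)) - (if b then 0 else 1))"
  using assms(3,4)
proof (induction t arbitrary: c d b)
  case 0
  then show ?case by (simp add: computation_paths_halted halts_within_0)
next
  case (Suc t)
  show ?case
    using length_succs_binary[OF assms(2) Suc.prems(2)]
  proof (cases rule: length_le_2_cases)
    case 1
    then show ?thesis by (simp add: computation_paths_halted)
  next
    case (2 c')
    with Suc.prems have "halts_within M c' t" "valid_config M c'"
      using halts_within_succ[of M c t 0] valid_succs[OF assms(1)] by auto
    with 2 Suc.IH show ?thesis by (simp add: card_computation_paths_one)
  next
    case (3 c0 c1)
    have h: "halts_within M c0 t" "halts_within M c1 t" "valid_config M c0" "valid_config M c1"
      using Suc.prems 3 halts_within_succ[of M c t 0] halts_within_succ[of M c t 1]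
        valid_succs[OF assms(1)] by auto
    have two: "{..<2} = {0, 1::nat}" by auto
    have "measure_pmf.expectation (descent M (Suc t) d b c) (\<lambda>v. v) =
        (measure_pmf.expectation (descent M t (Suc d) b c0) (\<lambda>v. v) +
         measure_pmf.expectation (descent M t (Suc d) True c1) (\<lambda>v. v)) / 2"
      using 3 by (simp add: pmf_expectation_bind_pmf_of_set finite_set_descent two)
    also have "\<dots> = 2 ^ d * (real (card (computation_paths M c0)) +
        real (card (computation_paths M c1)) - (if b then 0 else 1))"
      using h by (simp add: Suc.IH field_simps)
    finally show ?thesis
      using card_computation_paths_two[OF 3] finite_computation_paths h by simp
  qed
qed

text \<open>The path that was followed is exhibited, because \<open>nondet_bits\<close> is a maximum
  over paths and the bound \<open>N\<close> is obtained by comparing with it.\<close>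

lemma descent_le_branchings:
  assumes "wf_machine M" "binary_machine M" "halts_within M c t" "valid_config M c"
    and "v \<in> set_pmf (descent M t d b c)"
  shows "0 \<le> v \<and> (\<exists>ks \<in> computation_paths M c. v \<le> 2 ^ (d + branchings M c ks))"
  using assms(3-5)
proof (induction t arbitrary: c d b)
  case 0
  then show ?case by (auto simp: computation_paths_halted halts_within_0 split: if_splits)
next
  case (Suc t)
  show ?case
    using length_succs_binary[OF assms(2) Suc.prems(2)]
  proof (cases rule: length_le_2_cases)
    case 1
    with Suc.prems show ?thesis by (auto simp: computation_paths_halted split: if_splits)
  next
    case (2 c')
    with Suc.prems have "halts_within M c' t" "valid_config M c'" "v \<in> set_pmf (descent M t d b c')"
      using halts_within_succ[of M c t 0] valid_succs[OF assms(1)] by auto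
    with Suc.IH have "0 \<le> v" "\<exists>ks \<in> computation_paths M c'. v \<le> 2 ^ (d + branchings M c' ks)"
      by blast+
    then show ?thesis using 2 by (auto simp: computation_paths_step)
  next
    case (3 c0 c1)
    have "set_pmf (pmf_of_set {..<2::nat}) = {..<2}" by (subst set_pmf_of_set) (auto simp: lessThan_empty_iff)
    then obtain k where k: "k < 2" "v \<in> set_pmf (descent M t (Suc d) (b \<or> k = 1) (succs M c ! k))"
      using Suc.prems 3 by auto
    with 3 have k': "k < length (succs M c)" by simp
    have h: "halts_within M (succs M c ! k) t" "valid_config M (succs M c ! k)"
      using halts_within_succ[OF Suc.prems(1) k'] valid_succs[OF assms(1) Suc.prems(2) nth_mem[OF k']] .
    from Suc.IH[OF h k(2)] obtain ks where ks: "0 \<le> v" "ks \<in> computation_paths M (succs M c ! k)"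
      "v \<le> 2 ^ (Suc d + branchings M (succs M c ! k) ks)" by blast
    with 3 k have "k # ks \<in> computation_paths M c" "branchings M c (k # ks) = Suc (branchings M (succs M c ! k) ks)"
      by (auto simp: computation_paths_def)
    with ks show ?thesis by (metis add_Suc_shift)
  qed
qed

section \<open>Sums of independent samples: mean, variance, Chebyshev bound\<close>

primrec sum_pmf :: "real pmf \<Rightarrow> nat \<Rightarrow> real pmf" where
  "sum_pmf P 0 = return_pmf 0"
| "sum_pmf P (Suc r) = bind_pmf P (\<lambda>v. map_pmf (\<lambda>w. v + w) (sum_pmf P r))"

lemma finite_set_sum_pmf: "finite (set_pmf P) \<Longrightarrow> finite (set_pmf (sum_pmf P r))"
  by (induction r) auto

lemma expectation_sum_pmf_Suc:
  assumes "finite (set_pmf P)"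
  shows "measure_pmf.expectation (sum_pmf P (Suc r)) h =
    measure_pmf.expectation P (\<lambda>v. measure_pmf.expectation (sum_pmf P r) (\<lambda>w. h (v + w) :: real))"
proof -
  have "measure_pmf.expectation (sum_pmf P (Suc r)) h =
      (\<Sum>a\<in>set_pmf P. pmf P a *\<^sub>R measure_pmf.expectation (map_pmf (\<lambda>w. a + w) (sum_pmf P r)) h)"
    unfolding sum_pmf.simps
    by (rule pmf_expectation_bind) (auto simp: assms finite_set_sum_pmf)
  also have "\<dots> = measure_pmf.expectation P (\<lambda>v. measure_pmf.expectation (sum_pmf P r) (\<lambda>w. h (v + w)))"
    by (subst integral_measure_pmf[OF assms]) auto
  finally show ?thesis .
qed

lemma expectation_sum_pmf:
  assumes "finite (set_pmf P)"
  shows "measure_pmf.expectation (sum_pmf P r) (\<lambda>v. v) = r * measure_pmf.expectation P (\<lambda>v. v)"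
proof (induction r)
  case (Suc r)
  have int: "integrable (measure_pmf P) g" "integrable (measure_pmf (sum_pmf P r)) g" for g :: "real \<Rightarrow> real"
    by (auto intro!: integrable_measure_pmf_finite simp: assms finite_set_sum_pmf)
  show ?case
    by (simp only: expectation_sum_pmf_Suc[OF assms])
      (simp add: int Suc algebra_simps)
qed simp

text \<open>Independence is built into \<open>bind_pmf\<close>: for a fixed first sample, the cross
  term contains the expectation of the centred sum of the others, which vanishes by
  \<open>S0\<close>, so variances add.\<close>

lemma variance_sum_pmf:
  assumes "finite (set_pmf P)"
  defines "\<mu> \<equiv> measure_pmf.expectation P (\<lambda>v. v)"
  shows "measure_pmf.expectation (sum_pmf P r) (\<lambda>w. (w - r * \<mu>)\<^sup>2) =
    r * measure_pmf.expectation P (\<lambda>v. (v - \<mu>)\<^sup>2)"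
proof (induction r)
  case (Suc r)
  let ?E = "measure_pmf.expectation P" and ?S = "measure_pmf.expectation (sum_pmf P r)"
  have int: "integrable (measure_pmf P) g" "integrable (measure_pmf (sum_pmf P r)) g" for g :: "real \<Rightarrow> real"
    by (auto intro!: integrable_measure_pmf_finite simp: assms finite_set_sum_pmf)
  have S0: "?S (\<lambda>w. w - r * \<mu>) = 0"
    by (simp add: int expectation_sum_pmf[OF assms(1)] \<mu>_def)
  have "?S (\<lambda>w. (v + w - Suc r * \<mu>)\<^sup>2) = (v - \<mu>)\<^sup>2 + r * ?E (\<lambda>v. (v - \<mu>)\<^sup>2)" for v
  proof -
    have "(\<lambda>w. (v + w - Suc r * \<mu>)\<^sup>2) =
        (\<lambda>w. (v - \<mu>)\<^sup>2 + (2 * (v - \<mu>) * (w - r * \<mu>) + (w - r * \<mu>)\<^sup>2))"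
      by (auto simp: power2_eq_square algebra_simps)
    then have "?S (\<lambda>w. (v + w - Suc r * \<mu>)\<^sup>2) =
        ?S (\<lambda>w. (v - \<mu>)\<^sup>2 + (2 * (v - \<mu>) * (w - r * \<mu>) + (w - r * \<mu>)\<^sup>2))" by simp
    also have "\<dots> = (v - \<mu>)\<^sup>2 + (2 * (v - \<mu>) * ?S (\<lambda>w. w - r * \<mu>) + ?S (\<lambda>w. (w - r * \<mu>)\<^sup>2))"
      by (simp only: Bochner_Integration.integral_add[OF int(2) int(2)] integral_mult_right_zero)
        simp
    finally show ?thesis by (simp add: S0 Suc)
  qed
  then show ?case
    by (simp only: expectation_sum_pmf_Suc[OF assms(1)])
      (simp add: int algebra_simps)
qed simp

text \<open>Scores and their mean lie in the same interval of length \<open>N\<close>, so a single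
  score has variance at most \<open>N\<^sup>2\<close>. The tolerance is also proportional to
  \<open>N\<close>, which therefore cancels from the failure probability.\<close>

lemma chebyshev_sum_pmf:
  fixes P :: "real pmf" and N \<epsilon> :: real and k :: nat
  assumes fin: "finite (set_pmf P)" and bnd: "\<And>v. v \<in> set_pmf P \<Longrightarrow> 0 \<le> v \<and> v \<le> N"
    and "0 < k" "0 < \<epsilon>" "0 < N"
  defines "\<mu> \<equiv> measure_pmf.expectation P (\<lambda>v. v)"
  shows "measure_pmf.prob (sum_pmf P k) {w. \<bar>w / k - \<mu>\<bar> \<le> \<epsilon> * N} \<ge> 1 - 1 / (k * \<epsilon>\<^sup>2)"
proof -
  have int: "integrable (measure_pmf P) g" "integrable (measure_pmf (sum_pmf P k)) g" for g :: "real \<Rightarrow> real"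
    by (auto intro!: integrable_measure_pmf_finite simp: assms finite_set_sum_pmf)
  have mu: "0 \<le> \<mu>" "\<mu> \<le> N"
    unfolding \<mu>_def using bnd
    by (auto intro!: measure_pmf.integral_ge_const measure_pmf.integral_le_const int AE_pmfI)
  have "measure_pmf.expectation P (\<lambda>v. (v - \<mu>)\<^sup>2) \<le> N\<^sup>2"
  proof (intro measure_pmf.integral_le_const int AE_pmfI)
    fix v assume "v \<in> set_pmf P"
    with bnd mu have "\<bar>v - \<mu>\<bar> \<le> \<bar>N\<bar>" by (smt (verit))
    then show "(v - \<mu>)\<^sup>2 \<le> N\<^sup>2" by (simp add: abs_le_square_iff)
  qed
  then have var: "measure_pmf.expectation (sum_pmf P k) (\<lambda>w. (w - k * \<mu>)\<^sup>2) \<le> k * N\<^sup>2"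
    unfolding \<mu>_def variance_sum_pmf[OF fin] by (simp add: mult_left_mono)
  have "{w. \<not> \<bar>w / k - \<mu>\<bar> \<le> \<epsilon> * N} \<subseteq> {w. (w - k * \<mu>)\<^sup>2 \<ge> (k * \<epsilon> * N)\<^sup>2}"
  proof
    fix w assume "w \<in> {w. \<not> \<bar>w / k - \<mu>\<bar> \<le> \<epsilon> * N}"
    then have "\<epsilon> * N < \<bar>w / k - \<mu>\<bar>" by simp
    then have "k * (\<epsilon> * N) \<le> k * \<bar>w / k - \<mu>\<bar>" by (simp add: mult_left_mono)
    also have "\<dots> = \<bar>k * (w / k - \<mu>)\<bar>" by (simp add: abs_mult)
    also have "\<dots> = \<bar>w - k * \<mu>\<bar>" using \<open>0 < k\<close> by (simp add: algebra_simps)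
    finally have "(k * \<epsilon> * N)\<^sup>2 \<le> \<bar>w - k * \<mu>\<bar>\<^sup>2"
      using assms by (intro power_mono) (auto simp: mult.assoc)
    then show "w \<in> {w. (w - k * \<mu>)\<^sup>2 \<ge> (k * \<epsilon> * N)\<^sup>2}" by simp
  qed
  then have "measure_pmf.prob (sum_pmf P k) {w. \<not> \<bar>w / k - \<mu>\<bar> \<le> \<epsilon> * N}
      \<le> measure_pmf.prob (sum_pmf P k) {w. (w - k * \<mu>)\<^sup>2 \<ge> (k * \<epsilon> * N)\<^sup>2}"
    by (intro measure_pmf.finite_measure_mono) auto
  also have "\<dots> \<le> measure_pmf.expectation (sum_pmf P k) (\<lambda>w. (w - k * \<mu>)\<^sup>2) / (k * \<epsilon> * N)\<^sup>2"
    using integral_Markov_inequality_measure[of "measure_pmf (sum_pmf P k)" "\<lambda>w. (w - k * \<mu>)\<^sup>2" "{}" "(k * \<epsilon> * N)\<^sup>2"]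
      int assms by simp
  also have "\<dots> \<le> k * N\<^sup>2 / (k * \<epsilon> * N)\<^sup>2"
    using var by (rule divide_right_mono) simp
  also have "\<dots> = 1 / (k * \<epsilon>\<^sup>2)"
    using assms by (simp add: power2_eq_square field_simps)
  finally have le: "measure_pmf.prob (sum_pmf P k) {w. \<not> \<bar>w / k - \<mu>\<bar> \<le> \<epsilon> * N} \<le> 1 / (k * \<epsilon>\<^sup>2)" .
  have "{w. \<not> \<bar>w / k - \<mu>\<bar> \<le> \<epsilon> * N} = UNIV - {w. \<bar>w / k - \<mu>\<bar> \<le> \<epsilon> * N}" by auto
  with le measure_pmf.prob_compl[of "{w. \<bar>w / k - \<mu>\<bar> \<le> \<epsilon> * N}" "sum_pmf P k"]
  show ?thesis by simp
qed

subsection \<open>Binary numbers on tapes\<close>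

definition ones :: "(int \<Rightarrow> nat) \<Rightarrow> int set" where
  "ones g = {i. g i = 2}"

definition binval :: "(int \<Rightarrow> nat) \<Rightarrow> real" where
  "binval g = (\<Sum>i \<in> ones g. 2 powi (- i))"

lemma tape_value_eq_binval: "tape_value (g, p) = binval g"
  by (simp add: tape_value_def binval_def ones_def bit_sym_def)

text \<open>Symbols 1 and 2 are the digits 0 and 1, and weights grow to the left: this is the tape
  content left behind by adding a one at cell \<open>p\<close> when the carry passes
  \<open>j\<close> cells that hold the digit 1.\<close>

primrec carry :: "nat \<Rightarrow> (int \<Rightarrow> nat) \<Rightarrow> int \<Rightarrow> (int \<Rightarrow> nat)" where
  "carry 0 g p = g(p := 2)"
| "carry (Suc j) g p = carry j (g(p := 1)) (p - 1)"

lemma carry_outside: "i > p \<or> i < p - int j \<Longrightarrow> carry j g p i = g i"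
  by (induction j arbitrary: g p) auto

lemma carry_bit: "p - int j \<le> i \<Longrightarrow> i \<le> p \<Longrightarrow> carry j g p i \<in> {1, 2}"
proof (induction j arbitrary: g p)
  case (Suc j)
  show ?case
  proof (cases "i = p")
    case True
    then show ?thesis by (simp add: carry_outside)
  next
    case False
    then show ?thesis using Suc by simp
  qed
qed simp

text \<open>The value is kept at each passed cell because two units of its weight make one unit of
  its left neighbour. The last equation is the amortisation: the carry destroys \<open>j\<close>
  ones and creates one, so its length is paid for by the drop in the number of ones.\<close>

lemma carry_add:
  assumes "finite (ones g)" "\<And>i. i < j \<Longrightarrow> g (p - int i) = 2" "g (p - int j) \<noteq> 2"
  shows "finite (ones (carry j g p)) \<and> binval (carry j g p) = binval g + 2 powi (- p) \<and>
    card (ones (carry j g p)) + j = card (ones g) + 1"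
  using assms
proof (induction j arbitrary: g p)
  case 0
  then have "ones (g(p := 2)) = insert p (ones g)" "p \<notin> ones g" by (auto simp: ones_def)
  with 0 show ?case unfolding carry.simps binval_def by (simp del: fun_upd_apply)
next
  case (Suc j)
  have "g p = 2" using Suc.prems(2)[of 0] by simp
  then have o: "ones g = insert p (ones (g(p := 1)))" "p \<notin> ones (g(p := 1))" by (auto simp: ones_def)
  then have f: "finite (ones (g(p := 1)))" using Suc.prems(1) by simp
  then have v: "binval g = binval (g(p := 1)) + 2 powi (- p)" "card (ones g) = Suc (card (ones (g(p := 1))))"
    unfolding binval_def o(1) using o(2) f by (simp_all del: fun_upd_apply)
  have "(g(p := 1)) (p - 1 - int i) = 2" if "i < j" for i
    using Suc.prems(2)[of "Suc i"] that by (simp add: algebra_simps)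
  moreover have "(g(p := 1)) (p - 1 - int j) \<noteq> 2"
    using Suc.prems(3) by (simp add: algebra_simps)
  moreover have "2 powi (- (p - 1)) = 2 powi (- p) + (2 powi (- p) :: real)"
    by (simp add: power_int_diff field_simps power_int_minus)
  ultimately show ?case
    using Suc.IH[OF f, of "p - 1"] v unfolding carry.simps by (simp del: fun_upd_apply)
qed

lemma ex_carry_position:
  assumes "finite (ones g)"
  obtains j where "\<And>i. i < j \<Longrightarrow> g (p - int i) = 2" "g (p - int j) \<noteq> 2"
proof -
  have "\<exists>j. g (p - int j) \<noteq> 2"
  proof (rule ccontr)
    assume "\<nexists>j. g (p - int j) \<noteq> 2"
    then have "range (\<lambda>j. p - int j) \<subseteq> ones g" by (auto simp: ones_def)
    moreover have "infinite (range (\<lambda>j. p - int j))"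
      by (rule range_inj_infinite) (auto simp: inj_def)
    ultimately show False using assms finite_subset by blast
  qed
  then have "g (p - int (LEAST j. g (p - int j) \<noteq> 2)) \<noteq> 2" by (rule LeastI_ex)
  with that[of "LEAST j. g (p - int j) \<noteq> 2"] show thesis using not_less_Least by blast
qed

lemma geometric_fraction: "(\<Sum>i\<in>{1..int L}. 2 powi (- i)) = 1 - (2 powi (- int L) :: real)"
proof (induction L)
  case (Suc L)
  have "{1..int (Suc L)} = insert (int (Suc L)) {1..int L}" by auto
  moreover have "2 powi (- int L) = 2 * (2 powi (- int (Suc L)) :: real)"
    by (simp add: power_int_minus flip: of_nat_Suc)
  ultimately show ?case using Suc by (simp del: of_nat_Suc)
qed simp

subsection \<open>The sampling machine\<close>

text \<open>
  Tape 2 is the accumulator and tape 3 the counter; tapes 4, 5, ... are those of \<open>M\<close>. On tapes 2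
  and 3 the symbol 3 marks the cell to the right of the units digit, where the head rests between
  samples; on tape 3 it also marks cell 0, so that a carry arriving there ends the computation.
  During a descent the head of tape 2 moves left at each branching and thus counts them. The flag of
  \<open>Carry\<close> and \<open>Ret\<close> tells whether they act on tape 2, the other flags that the leftmost path has
  been left.
\<close>

datatype control = Init | Check | Scan | Scan2 | Pad nat | Copy | Rewind | Sim nat bool
  | SweepL bool | SweepR bool | Carry bool | Ret bool

text \<open>\<open>Init\<close> must receive the start state 0. From 14 on, the two infinite
  families are separated by residues modulo 3: \<open>Pad\<close> takes residue 2, and
  \<open>Sim\<close> takes 0 or 1 according to its flag.\<close>

primrec code :: "control \<Rightarrow> nat" where
  "code Init = 0"
| "code Check = 1"
| "code Scan = 2"
| "code Scan2 = 3"
| "code Copy = 4"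
| "code Rewind = 5"
| "code (SweepL b) = 6 + of_bool b"
| "code (SweepR b) = 8 + of_bool b"
| "code (Carry b) = 10 + of_bool b"
| "code (Ret b) = 12 + of_bool b"
| "code (Pad i) = 14 + 3 * i"
| "code (Sim q b) = 15 + 3 * q + of_bool b"

lemma code_inject: "code s = code s' \<longleftrightarrow> s = s'"
proof
  assume "code s = code s'"
  then show "s = s'"
    by (cases s; cases s'; simp add: of_bool_def split: if_splits; presburger?)
qed simp

definition stay :: "nat list \<Rightarrow> (nat \<times> move) list" where
  "stay ss = map (\<lambda>s. (s, Stay)) ss"

lemma list_split4:
  assumes "length ss = 4 + k"
  obtains x r a n ss' where "ss = x # r # a # n # ss'" "length ss' = k"
  using assms by (auto simp: length_Suc_conv numeral_eq_Suc)

lemma write_move_stay [simp]: "write_move (scan t, Stay) t = t"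
  by (cases t) (auto simp: write_move_def scan_def)

lemma map2_stay [simp]: "map2 write_move (stay (map scan ts)) ts = ts"
  by (induction ts) (auto simp: stay_def)

lemma write_move_scan: "write_move (scan t, d) t = (fst t, snd t + shift d)"
  by (simp add: write_move_def scan_def)

lemma scan_Pair [simp]: "scan (g, p) = g p"
  by (simp add: scan_def)

lemma write_move_Pair [simp]: "write_move (s, d) (g, p) = (g(p := s), p + shift d)"
  by (simp add: write_move_def)

lemma map2_map_scan: "map2 write_move (map h (map scan ts)) ts = map (\<lambda>t. write_move (h (scan t)) t) ts"
  by (induction ts) auto

section \<open>Nonblank intervals on tapes and how they are swept\<close>

text \<open>A nonblank symbol written inside an interval or directly beside it leaves an interval.
  Heads move by one cell and always write a nonblank, so they never get further away than
  that.\<close>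

lemma interval_insert:
  fixes a b p :: int
  assumes "\<And>i. g i \<noteq> (0::nat) \<longleftrightarrow> a \<le> i \<and> i < b" "a - 1 \<le> p" "p \<le> b" "a \<le> b" "b - a \<le> int u" "v \<noteq> 0"
  obtains a' b' where "\<forall>i. (g(p := v)) i \<noteq> 0 \<longleftrightarrow> a' \<le> i \<and> i < b'" "a' \<le> p" "p < b'" "b' - a' \<le> int (Suc u)"
proof (rule that)
  have "(g(p := v)) i \<noteq> 0 \<longleftrightarrow> min a p \<le> i \<and> i < max b (p + 1)" for i
    using assms(1)[of i] assms(2-) by auto
  then show "\<forall>i. (g(p := v)) i \<noteq> 0 \<longleftrightarrow> min a p \<le> i \<and> i < max b (p + 1)" ..
  show "max b (p + 1) - min a p \<le> int (Suc u)" using assms(2-5) by linarith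
qed simp_all

lemma power_int_diff_nat: "2 powi (- (int L - int d)) = (2 ^ d / 2 ^ L :: real)"
  unfolding minus_diff_eq by (subst power_int_diff) simp_all

lemma string_tape_nonblank: "fst (string_tape x) i \<noteq> 0 \<longleftrightarrow> 0 \<le> i \<and> i < int (length x)"
  by (auto simp: string_tape_def bit_sym_def)

text \<open>The state of a tape during the erasing sweep to the right: the head is on the left end
  of what is left to erase, and \<open>n\<close> bounds the remaining steps.\<close>

definition nonblank_from :: "tape \<Rightarrow> nat \<Rightarrow> bool" where
  "nonblank_from t n \<longleftrightarrow> (\<exists>k \<le> n. \<forall>i. fst t i \<noteq> 0 \<longleftrightarrow> snd t \<le> i \<and> i < snd t + int k)"

text \<open>The state of a tape during the sweep to the left: \<open>n\<close> bounds the distance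
  to the blank just before the interval, while \<open>u\<close> bounds the whole length and thereby
  the cost of the later sweep to the right.\<close>

definition nonblank_around :: "tape \<Rightarrow> nat \<Rightarrow> nat \<Rightarrow> bool" where
  "nonblank_around t u n \<longleftrightarrow> (\<exists>a b. (\<forall>i. fst t i \<noteq> 0 \<longleftrightarrow> a \<le> i \<and> i < b) \<and> a - 1 \<le> snd t \<and> snd t < b \<and>
     b - a \<le> int u \<and> snd t + 1 - a \<le> int n)"

lemma nonblank_from_scan_0: "nonblank_from t n \<Longrightarrow> scan t = 0 \<Longrightarrow> fst t = (\<lambda>_. 0)"
proof -
  assume "nonblank_from t n" and s: "scan t = 0"
  then obtain k where k: "\<forall>i. fst t i \<noteq> 0 \<longleftrightarrow> snd t \<le> i \<and> i < snd t + int k"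
    unfolding nonblank_from_def by blast
  from s have "fst t (snd t) = 0" by (simp add: scan_def)
  then have "k = 0" using spec[OF k, of "snd t"] by simp
  then have "fst t i = 0" for i using spec[OF k, of i] by linarith
  then show ?thesis by (rule ext)
qed

lemma nonblank_from_erase:
  assumes "nonblank_from t (Suc n)"
  shows "nonblank_from (write_move (0, if scan t = 0 then Stay else MoveR) t) n"
proof (cases "scan t = 0")
  case True
  with assms have "fst t = (\<lambda>_. 0)" by (rule nonblank_from_scan_0)
  with True show ?thesis
    by (auto simp: nonblank_from_def write_move_def intro!: exI[of _ 0])
next
  case False
  from assms obtain k where k: "k \<le> Suc n" "\<forall>i. fst t i \<noteq> 0 \<longleftrightarrow> snd t \<le> i \<and> i < snd t + int k"
    unfolding nonblank_from_def by blast
  from False k(2) have "0 < k" by (auto simp: scan_def)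
  then have "((fst t)(snd t := 0)) i \<noteq> 0 \<longleftrightarrow> snd t + 1 \<le> i \<and> i < snd t + 1 + int (k - 1)" for i
    using spec[OF k(2), of i] by auto
  with k(1) False show ?thesis
    unfolding nonblank_from_def write_move_def by (intro exI[of _ "k - 1"]) (simp del: fun_upd_apply)
qed

lemma nonblank_around_scan_0:
  assumes "nonblank_around t u n" "scan t = 0"
  shows "nonblank_from (fst t, snd t + 1) u"
proof -
  from assms(1) obtain a b where ab: "\<forall>i. fst t i \<noteq> 0 \<longleftrightarrow> a \<le> i \<and> i < b" "a - 1 \<le> snd t" "snd t < b"
     "b - a \<le> int u" unfolding nonblank_around_def by blast
  with assms(2) have "snd t + 1 = a" using spec[OF ab(1), of "snd t"] by (simp add: scan_def)
  with ab show ?thesis unfolding nonblank_from_def by (intro exI[of _ "nat (b - a)"]) auto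
qed

lemma nonblank_around_0:
  assumes "nonblank_around t u 0"
  shows "scan t = 0"
proof -
  from assms obtain a b where ab: "\<forall>i. fst t i \<noteq> 0 \<longleftrightarrow> a \<le> i \<and> i < b" "snd t + 1 - a \<le> 0"
    unfolding nonblank_around_def by auto
  then show ?thesis using spec[OF ab(1), of "snd t"] unfolding scan_def by linarith
qed

lemma nonblank_around_left:
  assumes "nonblank_around t u (Suc n)"
  shows "nonblank_around (write_move (scan t, if scan t = 0 then Stay else MoveL) t) u n"
proof -
  from assms obtain a b where ab: "\<forall>i. fst t i \<noteq> 0 \<longleftrightarrow> a \<le> i \<and> i < b" "a - 1 \<le> snd t" "snd t < b"
     "b - a \<le> int u" "snd t + 1 - a \<le> int (Suc n)" unfolding nonblank_around_def by blast
  show ?thesis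
  proof (cases "scan t = 0")
    case True
    then have "\<not> (a \<le> snd t \<and> snd t < b)" using spec[OF ab(1), of "snd t"] by (simp add: scan_def)
    with ab(3) have "snd t + 1 - a \<le> int n" by simp
    with True ab show ?thesis
      unfolding nonblank_around_def write_move_scan by (intro exI[of _ a] exI[of _ b]) simp
  next
    case False
    then have "a \<le> snd t" using spec[OF ab(1), of "snd t"] by (simp add: scan_def)
    with False ab show ?thesis
      unfolding nonblank_around_def write_move_scan by (intro exI[of _ a] exI[of _ b]) simp
  qed
qed

text \<open>The absence of 3 up to the units cell \<open>L\<close> makes the marker at
  \<open>L + 1\<close> the place where a head returning from the left stops. There is no left
  marker, as the integer part may grow; finiteness of the ones is what ends a carry.\<close>

definition accumulator :: "nat \<Rightarrow> (int \<Rightarrow> nat) \<Rightarrow> bool" where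
  "accumulator L g \<longleftrightarrow> finite (ones g) \<and> g (int L + 1) = 3 \<and> (\<forall>i \<le> int L. g i \<noteq> 3)"

text \<open>Only the \<open>L\<close> cells between the two markers hold digits, so the counter
  takes exactly \<open>2 ^ L\<close> values and the next increment runs into the marker at
  0.\<close>

definition counter :: "nat \<Rightarrow> (int \<Rightarrow> nat) \<Rightarrow> bool" where
  "counter L g \<longleftrightarrow> ones g \<subseteq> {1..int L} \<and> g 0 = 3 \<and> g (int L + 1) = 3 \<and> (\<forall>i \<in> {1..int L}. g i \<noteq> 3)"

lemma accumulator_carry:
  assumes "accumulator L g" "p \<le> int L" "\<And>i. i < j \<Longrightarrow> g (p - int i) = 2" "g (p - int j) \<noteq> 2"
  shows "accumulator L (carry j g p)"
proof -
  have "carry j g p i \<noteq> 3" if "i \<le> int L" for i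
  proof (cases "p - int j \<le> i \<and> i \<le> p")
    case True
    then show ?thesis using carry_bit[of p j i g] by auto
  next
    case False
    then show ?thesis using carry_outside[of p i j g] that assms(1) by (auto simp: accumulator_def)
  qed
  moreover have "finite (ones g)" using assms(1) by (simp add: accumulator_def)
  from carry_add[OF this assms(3,4)] have "finite (ones (carry j g p))" by simp
  moreover have "carry j g p (int L + 1) = 3"
    using assms(1,2) by (subst carry_outside) (auto simp: accumulator_def)
  ultimately show ?thesis by (simp add: accumulator_def)
qed

lemma counter_carry:
  assumes "counter L g" "j < L" "\<And>i. i < j \<Longrightarrow> g (int L - int i) = 2" "g (int L - int j) \<noteq> 2"
  shows "counter L (carry j g (int L))"
proof -
  have in': "carry j g (int L) i \<in> {1, 2}" if "int L - int j \<le> i" "i \<le> int L" for i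
    using carry_bit[of "int L" j i g] that by simp
  have out: "carry j g (int L) i = g i" if "\<not> (int L - int j \<le> i \<and> i \<le> int L)" for i
    using carry_outside[of "int L" i j g] that by auto
  have "carry j g (int L) i \<noteq> 3" if "i \<in> {1..int L}" for i
    using in'[of i] out[of i] that assms(1) by (cases "int L - int j \<le> i") (auto simp: counter_def)
  moreover have "i \<in> {1..int L}" if "carry j g (int L) i = 2" for i
    using in'[of i] out[of i] that assms(1,2)
    by (cases "int L - int j \<le> i \<and> i \<le> int L") (auto simp: counter_def ones_def)
  moreover have "carry j g (int L) 0 = 3" "carry j g (int L) (int L + 1) = 3"
    using out[of 0] out[of "int L + 1"] assms(1,2) by (auto simp: counter_def)
  ultimately show ?thesis by (auto simp: counter_def ones_def)
qed

text \<open>The value is read as a countdown: \<open>r\<close> increments remain, the last of which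
  overflows. With all \<open>L\<close> digits equal to 1 the value is
  \<open>1 - 2 powi (- int L)\<close>, and any missing digit makes it strictly smaller.\<close>

lemma counter_full:
  assumes "counter L g" "binval g = 1 - real r * 2 powi (- int L)"
  shows "ones g = {1..int L} \<longleftrightarrow> r = 1"
proof
  have pos: "(0::real) < 2 powi (- int L)" by simp
  assume "ones g = {1..int L}"
  then have "binval g = 1 - 2 powi (- int L)" by (simp only: binval_def geometric_fraction)
  with assms(2) have "real r * 2 powi (- int L) = 1 * 2 powi (- int L)" by simp
  then show "r = 1" using pos by (metis mult_right_cancel of_nat_eq_1_iff less_irrefl)
next
  assume "r = 1"
  show "ones g = {1..int L}"
  proof (rule ccontr)
    assume "ones g \<noteq> {1..int L}"
    with assms(1) have "ones g \<subset> {1..int L}" by (auto simp: counter_def)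
    then obtain i where i: "i \<in> {1..int L} - ones g" and sub: "ones g \<subseteq> {1..int L}" by blast
    have "binval g < (\<Sum>i\<in>{1..int L}. 2 powi (- i))"
      unfolding binval_def using i sub by (intro sum_strict_mono2[of _ _ i]) auto
    then show False using assms(2) \<open>r = 1\<close> by (simp add: geometric_fraction)
  qed
qed

section \<open>Reading the order of magnitude of \<open>\<xi>\<close> from its expansion\<close>

text \<open>Two cells suffice to recognise \<open>\<xi>\<close> as large: if the units digit is 0
  although \<open>1 \<le> \<xi>\<close>, then the integer part is at least 2 and has a digit in cell
  -1.\<close>

lemma real_tape_large:
  assumes "1 \<le> \<xi>"
  shows "fst (real_tape \<xi>) 0 = 2 \<or> fst (real_tape \<xi>) (-1) \<noteq> 0"
proof (cases "odd \<lfloor>\<xi>\<rfloor>")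
  case False
  moreover have "1 \<le> \<lfloor>\<xi>\<rfloor>" using assms by simp
  ultimately have "2 \<le> \<lfloor>\<xi>\<rfloor>" by presburger
  then have "2 \<le> \<xi>" by linarith
  then show ?thesis by (simp add: real_tape_def bit_sym_def)
qed (simp add: real_tape_def bit_sym_def)

lemma real_tape_small:
  assumes "0 < \<xi>" "\<xi> < 1"
  obtains m where "1 \<le> \<xi> * 2 ^ m" "\<xi> * 2 ^ m < 2" "fst (real_tape \<xi>) (-1) = 0"
    "\<And>i. 0 \<le> i \<Longrightarrow> i < int m \<Longrightarrow> fst (real_tape \<xi>) i \<noteq> 2" "fst (real_tape \<xi>) (int m) = 2" "0 < m"
proof -
  have "\<exists>m. 1 \<le> \<xi> * 2 ^ m"
  proof -
    obtain m where "1 / \<xi> < 2 ^ m" using real_arch_pow[of 2 "1 / \<xi>"] by auto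
    then have "1 \<le> \<xi> * 2 ^ m" using assms(1) by (simp add: field_simps)
    then show ?thesis ..
  qed
  \<comment> \<open>The leading digit of \<open>\<xi>\<close> has weight \<open>2 ^ (- m)\<close>;
    minimality gives both the upper bound 2 and the zeros in front of it.\<close>
  define m where "m = (LEAST m. 1 \<le> \<xi> * 2 ^ m)"
  have m1: "1 \<le> \<xi> * 2 ^ m" unfolding m_def using \<open>\<exists>m. 1 \<le> \<xi> * 2 ^ m\<close> by (rule LeastI_ex)
  have less: "\<xi> * 2 ^ i < 1" if "i < m" for i
    using not_less_Least[of i "\<lambda>m. 1 \<le> \<xi> * 2 ^ m"] that by (simp add: m_def)
  have "0 < m" using m1 assms(2) by (cases m) auto
  then have m2: "\<xi> * 2 ^ m < 2" using less[of "m - 1"] by (cases m) auto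
  have "fst (real_tape \<xi>) i \<noteq> 2" if "0 \<le> i" "i < int m" for i
  proof -
    have "\<xi> * 2 powi i < 1" using less[of "nat i"] that by (simp add: power_int_def)
    then have "\<lfloor>\<xi> * 2 powi i\<rfloor> = 0" using assms(1) by (simp add: floor_eq_iff)
    with that show ?thesis by (simp add: real_tape_def bit_sym_def)
  qed
  moreover have "fst (real_tape \<xi>) (int m) = 2"
  proof -
    have "\<lfloor>\<xi> * 2 powi int m\<rfloor> = 1" using m1 m2 by (simp add: floor_eq_iff)
    then show ?thesis by (simp add: real_tape_def bit_sym_def)
  qed
  moreover have "fst (real_tape \<xi>) (-1) = 0" using assms by (simp add: real_tape_def)
  ultimately show thesis using that m1 m2 \<open>0 < m\<close> by blast
qed

text \<open>\<open>pad\<close> carries the dependence on \<open>\<delta>\<close>: once the leading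
  digit of \<open>\<xi>\<close> is found in cell \<open>m\<close>, the markers are put at
  \<open>2 * m + pad\<close>. As a marker is one cell beyond the units digit, \<open>pad\<close> is
  one more than the constant in \<open>L\<close>.\<close>

locale sampler =
  fixes M :: machine and pad :: nat
  assumes wf: "wf_machine M" and bin: "binary_machine M"
begin

text \<open>
  On the simulated tapes the extra symbol \<open>num_syms M\<close> stands for a blank in a cell that has been
  visited, so that the cells to be erased after a run form an interval without genuine blanks.
\<close>

definition dec :: "nat \<Rightarrow> nat" where
  "dec s = (if s < num_syms M then s else 0)"

definition enc :: "nat \<Rightarrow> nat" where
  "enc s = (if s = 0 then num_syms M else s)"

text \<open>The head of tape 2 starts a descent one cell to the right of the units digit; the
  additional \<open>MoveL\<close> at a leaf brings it to the cell of weight \<open>2 ^ d\<close>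
  relative to the units cell. The same step turns the scanned cells into visited ones, so that the
  sweep to the left does not stop at once on a fresh blank. Halting occurs for large
  \<open>\<xi>\<close> in \<open>Init\<close> or \<open>Check\<close>, with an empty output tape,
  and otherwise in \<open>Carry False\<close> on the marker in cell 0.\<close>

fun delta :: "control \<Rightarrow> nat \<Rightarrow> nat \<Rightarrow> nat \<Rightarrow> nat \<Rightarrow> nat list \<Rightarrow> (control \<times> (nat \<times> move) list) list" where
  "delta Init x r a n ss = (if r = 2 then []
     else [(Check, (x, Stay) # (r, MoveL) # (a, Stay) # (3, Stay) # stay ss)])"
| "delta Check x r a n ss = (if r \<noteq> 0 then []
     else [(Scan, (x, Stay) # (r, MoveR) # (a, Stay) # (n, Stay) # stay ss)])"
| "delta Scan x r a n ss = (if r = 2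
     then [(Pad pad, (x, Stay) # (r, Stay) # (a, Stay) # (n, Stay) # stay ss)]
     else [(Scan2, (x, Stay) # (r, Stay) # (a, MoveR) # (n, MoveR) # stay ss)])"
| "delta Scan2 x r a n ss = [(Scan, (x, Stay) # (r, MoveR) # (a, MoveR) # (n, MoveR) # stay ss)]"
| "delta (Pad i) x r a n ss = (case i of
     0 \<Rightarrow> [(Copy, (x, Stay) # (r, Stay) # (3, Stay) # (3, Stay) # stay ss)]
   | Suc i' \<Rightarrow> [(Pad i', (x, Stay) # (r, Stay) # (a, MoveR) # (n, MoveR) # stay ss)])"
| "delta Copy x r a n ss = (if x = 0
     then [(Rewind, (x, MoveL) # (r, Stay) # (a, Stay) # (n, Stay) # (hd ss, MoveL) # stay (tl ss))]
     else [(Copy, (x, MoveR) # (r, Stay) # (a, Stay) # (n, Stay) # (x, MoveR) # stay (tl ss))])"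
| "delta Rewind x r a n ss = (if x = 0
     then [(Sim 0 False, (x, MoveR) # (r, Stay) # (a, Stay) # (n, Stay) # (hd ss, MoveR) # stay (tl ss))]
     else [(Rewind, (x, MoveL) # (r, Stay) # (a, Stay) # (n, Stay) # (hd ss, MoveL) # stay (tl ss))])"
| "delta (Sim q b) x r a n ss = (case trans M q (map dec ss) of
     [] \<Rightarrow> [(SweepL b, (x, Stay) # (r, Stay) # (a, MoveL) # (n, Stay) # map (\<lambda>s. (enc s, Stay)) ss)]
   | [(q', ws)] \<Rightarrow>
       [(Sim q' b, (x, Stay) # (r, Stay) # (a, Stay) # (n, Stay) # map (apfst enc) ws)]
   | [(q0, ws0), (q1, ws1)] \<Rightarrow>
       [(Sim q0 b, (x, Stay) # (r, Stay) # (a, MoveL) # (n, Stay) # map (apfst enc) ws0),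
        (Sim q1 True, (x, Stay) # (r, Stay) # (a, MoveL) # (n, Stay) # map (apfst enc) ws1)]
   | _ \<Rightarrow> [])"
| "delta (SweepL b) x r a n ss = (if set ss \<subseteq> {0}
     then [(SweepR b, (x, Stay) # (r, Stay) # (a, Stay) # (n, Stay) # map (\<lambda>s. (s, MoveR)) ss)]
     else [(SweepL b, (x, Stay) # (r, Stay) # (a, Stay) # (n, Stay) #
             map (\<lambda>s. (s, if s = 0 then Stay else MoveL)) ss)])"
| "delta (SweepR b) x r a n ss = (if set ss \<subseteq> {0}
     then [(if b then Carry True else Ret True, (x, Stay) # (r, Stay) # (a, Stay) # (n, Stay) # stay ss)]
     else [(SweepR b, (x, Stay) # (r, Stay) # (a, Stay) # (n, Stay) #
             map (\<lambda>s. (0, if s = 0 then Stay else MoveR)) ss)])"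
| "delta (Carry b) x r a n ss = (let
     next = (\<lambda>s' w. [(s', (x, Stay) # (r, Stay) # (if b then w else (a, Stay)) #
                        (if b then (n, Stay) else w) # stay ss)]);
     s = (if b then a else n) in
     if s = 2 then next (Carry b) (1, MoveL) else if s = 3 then [] else next (Ret b) (2, Stay))"
| "delta (Ret b) x r a n ss = (
     if (if b then a else n) = 3
     then [(if b then Carry False else Copy,
        (x, Stay) # (r, Stay) # (a, Stay) # (n, if b then MoveL else Stay) # stay ss)]
     else [(Ret b, (x, Stay) # (r, Stay) # (a, if b then MoveR else Stay) #
              (n, if b then Stay else MoveR) # stay ss)])"

primrec reachable :: "control \<Rightarrow> bool" where
  "reachable Init = True"
| "reachable Check = True"
| "reachable Scan = True"
| "reachable Scan2 = True"
| "reachable Copy = True"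
| "reachable Rewind = True"
| "reachable (SweepL b) = True"
| "reachable (SweepR b) = True"
| "reachable (Carry b) = True"
| "reachable (Ret b) = True"
| "reachable (Pad i) = (i \<le> pad)"
| "reachable (Sim q b) = (q < num_states M)"

text \<open>The number of states is merely an upper bound for the codes; numbers that code no
  reachable state halt. If \<open>num_syms M = 3\<close>, the marker 3 and the visited blank are the
  same symbol, which is harmless because they occur on different tapes.\<close>

definition sampling_machine :: machine where
  "sampling_machine = \<lparr>num_tapes = 4 + num_tapes M, num_states = 20 + 3 * (pad + num_states M),
     num_syms = Suc (num_syms M),
     trans = (\<lambda>q ss. if \<exists>s. reachable s \<and> code s = q
       then map (apfst code) (delta (THE s. code s = q) (ss ! 0) (ss ! 1) (ss ! 2) (ss ! 3) (drop 4 ss))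
       else [])\<rparr>"

section \<open>The sampling machine is a randomized algorithm\<close>

lemma M_bounds: "1 \<le> num_tapes M" "1 \<le> num_states M" "3 \<le> num_syms M"
  using wf by (auto simp: wf_machine_def)

lemma trans_sampling_machine:
  assumes "reachable s"
  shows "trans sampling_machine (code s) (x # r # a # n # ss) = map (apfst code) (delta s x r a n ss)"
proof -
  have "(THE s'. code s' = code s) = s" by (simp add: code_inject)
  with assms show ?thesis by (auto simp: sampling_machine_def numeral_eq_Suc)
qed

lemma code_bound: "reachable s \<Longrightarrow> code s < 20 + 3 * (pad + num_states M)"
  by (cases s) (auto simp: of_bool_def)

lemma dec_bound: "dec s < num_syms M"
  using M_bounds by (simp add: dec_def)

lemma trans_dec:
  assumes "q < num_states M" "length ss = num_tapes M"
  shows "length (trans M q (map dec ss)) \<le> 2"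
    and "(q', ws) \<in> set (trans M q (map dec ss)) \<Longrightarrow> q' < num_states M \<and> length ws = num_tapes M \<and>
      (\<forall>(s, d) \<in> set ws. s < num_syms M)"
proof -
  have *: "q < num_states M \<and> length (map dec ss) = num_tapes M \<and> set (map dec ss) \<subseteq> {..<num_syms M}"
    using assms dec_bound by auto
  with bin show "length (trans M q (map dec ss)) \<le> 2" unfolding binary_machine_def by blast
  from * wf have "\<forall>(q', ws) \<in> set (trans M q (map dec ss)). q' < num_states M \<and> length ws = num_tapes M \<and>
      (\<forall>(s, d) \<in> set ws. s < num_syms M)" unfolding wf_machine_def by blast
  then show "(q', ws) \<in> set (trans M q (map dec ss)) \<Longrightarrow> q' < num_states M \<and> length ws = num_tapes M \<and>
      (\<forall>(s, d) \<in> set ws. s < num_syms M)" by blast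
qed

lemma delta_wf:
  assumes "reachable s" "length ss = num_tapes M" "\<forall>v \<in> set (x # r # a # n # ss). v \<le> num_syms M"
    and "(s', ws) \<in> set (delta s x r a n ss)"
  shows "reachable s' \<and> length ws = 4 + num_tapes M \<and> (\<forall>(v, d) \<in> set ws. v \<le> num_syms M)"
proof -
  obtain y ys where ss: "ss = y # ys" using assms(2) M_bounds by (cases ss) auto
  show ?thesis
  proof (cases s)
    case (Sim q b)
    with assms(1) have q: "q < num_states M" by simp
    have e: "v \<le> num_syms M \<Longrightarrow> enc v \<le> num_syms M" for v by (simp add: enc_def)
    from trans_dec(1)[OF q assms(2)] show ?thesis
    proof (cases rule: length_le_2_cases)
      case 1
      with assms Sim e show ?thesis by auto
    next
      case (2 a1)
      obtain q' ws' where a1: "a1 = (q', ws')" by (cases a1)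
      have "q' < num_states M \<and> length ws' = num_tapes M \<and> (\<forall>(s, d) \<in> set ws'. s < num_syms M)"
        using trans_dec(2)[OF q assms(2), of q' ws'] 2 a1 by simp
      with 2 a1 assms Sim e show ?thesis by (fastforce simp: less_imp_le)
    next
      case (3 a1 a2)
      obtain q' ws' q2 ws2 where a1: "a1 = (q', ws')" "a2 = (q2, ws2)" by (cases a1; cases a2)
      have "q' < num_states M \<and> length ws' = num_tapes M \<and> (\<forall>(s, d) \<in> set ws'. s < num_syms M)"
           "q2 < num_states M \<and> length ws2 = num_tapes M \<and> (\<forall>(s, d) \<in> set ws2. s < num_syms M)"
        using trans_dec(2)[OF q assms(2), of q' ws'] trans_dec(2)[OF q assms(2), of q2 ws2] 3 a1 by auto
      with 3 a1 assms Sim e show ?thesis by (fastforce simp: less_imp_le)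
    qed
  qed (use assms M_bounds ss in \<open>auto simp: stay_def Let_def split: if_splits nat.splits\<close>)
qed

lemma delta_binary:
  assumes "reachable s" "length ss = num_tapes M"
  shows "length (delta s x r a n ss) \<le> 2"
  using assms by (cases s) (auto simp: Let_def split: list.splits nat.splits)

lemma sampling_machine_trans_cases:
  assumes "length ss = num_tapes sampling_machine" "set ss \<subseteq> {..<num_syms sampling_machine}"
    and "trans sampling_machine q ss \<noteq> []"
  obtains s x r a n ss' where "reachable s" "q = code s" "ss = x # r # a # n # ss'" "length ss' = num_tapes M"
    "\<forall>v \<in> set (x # r # a # n # ss'). v \<le> num_syms M"
    "trans sampling_machine q ss = map (apfst code) (delta s x r a n ss')"
proof -
  from assms(1) have "length ss = 4 + num_tapes M" by (simp add: sampling_machine_def)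
  then obtain x r a n ss' where ss: "ss = x # r # a # n # ss'" "length ss' = num_tapes M"
    by (rule list_split4)
  from assms(3) obtain s where s: "reachable s" "q = code s"
    by (auto simp: sampling_machine_def split: if_splits)
  have "\<forall>v \<in> set (x # r # a # n # ss'). v \<le> num_syms M"
    using assms(2) ss by (auto simp: sampling_machine_def less_Suc_eq_le)
  then show thesis
    using that[OF s ss] trans_sampling_machine[OF s(1)] ss s by simp
qed

lemma randomized_algorithm_sampling_machine: "randomized_algorithm sampling_machine"
proof -
  let ?A = sampling_machine
  have "q' < num_states ?A \<and> length ws = num_tapes ?A \<and> (\<forall>(s, d) \<in> set ws. s < num_syms ?A)"
    if h: "length ss = num_tapes ?A" "set ss \<subseteq> {..<num_syms ?A}" "(q', ws) \<in> set (trans ?A q ss)" for q ss q' ws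
  proof -
    from h(3) have "trans ?A q ss \<noteq> []" by auto
    from sampling_machine_trans_cases[OF h(1,2) this] obtain s x r a n ss'
      where *: "reachable s" "length ss' = num_tapes M" "\<forall>v \<in> set (x # r # a # n # ss'). v \<le> num_syms M"
        "trans ?A q ss = map (apfst code) (delta s x r a n ss')" by metis
    from h(3) *(4) obtain s' where "(s', ws) \<in> set (delta s x r a n ss')" "q' = code s'" by auto
    with delta_wf[OF *(1-3)] code_bound show ?thesis
      by (fastforce simp: sampling_machine_def less_Suc_eq_le)
  qed
  moreover have bounds: "1 \<le> num_tapes ?A \<and> 1 \<le> num_states ?A \<and> 3 \<le> num_syms ?A"
    using M_bounds by (simp add: sampling_machine_def)
  ultimately have "wf_machine ?A"
    unfolding wf_machine_def using bounds by fast
  moreover have "length (trans ?A q ss) \<le> 2"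
    if h: "length ss = num_tapes ?A" "set ss \<subseteq> {..<num_syms ?A}" for q ss
  proof (cases "trans ?A q ss = []")
    case False
    from sampling_machine_trans_cases[OF h False] obtain s x r a n ss'
      where "reachable s" "length ss' = num_tapes M"
        "trans ?A q ss = map (apfst code) (delta s x r a n ss')" by metis
    then show ?thesis using delta_binary by simp
  qed simp
  then have "binary_machine ?A" unfolding binary_machine_def by blast
  ultimately show ?thesis
    by (simp add: randomized_algorithm_def sampling_machine_def)
qed

section \<open>Carries, returns and sweeps with their running times\<close>

abbreviation conf :: "control \<Rightarrow> tape \<Rightarrow> tape \<Rightarrow> tape \<Rightarrow> tape \<Rightarrow> tape list \<Rightarrow> config" where
  "conf s tx tr ta tn ts \<equiv> (code s, tx # tr # ta # tn # ts)"

lemma succs_sampling_machine: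
  assumes "reachable s"
  shows "succs sampling_machine (conf s tx tr ta tn ts) =
    map (\<lambda>(s', ws). (code s', map2 write_move ws (tx # tr # ta # tn # ts)))
      (delta s (scan tx) (scan tr) (scan ta) (scan tn) (map scan ts))"
  using assms by (simp add: succs_def trans_sampling_machine perform_def case_prod_beta)

declare code.simps [simp del]

abbreviation "A \<equiv> sampling_machine"

lemma estimates_delta:
  assumes "reachable s" "delta s (scan tx) (scan tr) (scan ta) (scan tn) (map scan ts) = [(s', ws)]"
    and "estimates A (code s', map2 write_move ws (tx # tr # ta # tn # ts)) T D"
  shows "estimates A (conf s tx tr ta tn ts) (Suc T) D"
  by (rule estimates_step[OF _ assms(3)]) (simp add: succs_sampling_machine assms)

text \<open>\<open>u\<close> is the tape acted on and \<open>w\<close> the bystander; the flag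
  decides which of them is the accumulator, so that \<open>Carry\<close> and \<open>Ret\<close> are
  analysed once for both tapes.\<close>

definition conf2 :: "bool \<Rightarrow> control \<Rightarrow> tape \<Rightarrow> tape \<Rightarrow> tape \<Rightarrow> tape \<Rightarrow> tape list \<Rightarrow> config" where
  "conf2 b s tx tr u w ts = (if b then conf s tx tr u w ts else conf s tx tr w u ts)"

lemma estimates_carry:
  assumes "\<And>i. i < j \<Longrightarrow> g (p - int i) = 2" "g (p - int j) \<noteq> 2" "g (p - int j) \<noteq> 3"
    and "estimates A (conf2 b (Ret b) tx tr (carry j g p, p - int j) w ts) T D"
  shows "estimates A (conf2 b (Carry b) tx tr (g, p) w ts) (T + j + 1) D"
  using assms
proof (induction j arbitrary: g p)
  case 0
  have "estimates A (conf2 b (Carry b) tx tr (g, p) w ts) (Suc T) D"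
    using 0 unfolding carry.simps
    by (cases b) (auto simp: conf2_def simp del: fun_upd_apply intro!: estimates_delta)
  then show ?case by simp
next
  case (Suc j)
  have "estimates A (conf2 b (Carry b) tx tr (g(p := 1), p - 1) w ts) (T + j + 1) D"
  proof (rule Suc.IH)
    show "(g(p := 1)) (p - 1 - int i) = 2" if "i < j" for i
      using Suc.prems(1)[of "Suc i"] that by (simp add: algebra_simps)
    show "(g(p := 1)) (p - 1 - int j) \<noteq> 2" "(g(p := 1)) (p - 1 - int j) \<noteq> 3"
      using Suc.prems(2,3) by (simp_all add: algebra_simps)
    show "estimates A (conf2 b (Ret b) tx tr (carry j (g(p := 1)) (p - 1), p - 1 - int j) w ts) T D"
      using Suc.prems(4) by (simp add: algebra_simps)
  qed
  moreover have "g p = 2" using Suc.prems(1)[of 0] by simp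
  ultimately have "estimates A (conf2 b (Carry b) tx tr (g, p) w ts) (Suc (T + j + 1)) D"
    by (cases b) (auto simp: conf2_def simp del: fun_upd_apply intro!: estimates_delta)
  then show ?case by simp
qed

text \<open>The end of the whole computation: a carry through the full counter destroys its content,
  but the result is on the other tape.\<close>

lemma estimates_overflow:
  assumes "\<And>i. i < j \<Longrightarrow> g (p - int i) = 2" "g (p - int j) = 3"
  shows "estimates A (conf (Carry False) tx tr ta (g, p) ts) j (return_pmf (tape_value ta))"
  using assms
proof (induction j arbitrary: g p)
  case 0
  then have "succs A (conf (Carry False) tx tr ta (g, p) ts) = []"
    by (simp add: succs_sampling_machine scan_def)
  from estimates_halted[OF this] show ?case by (simp add: estimate_def)
next
  case (Suc j)
  have "estimates A (conf (Carry False) tx tr ta (g(p := 1), p - 1) ts) j (return_pmf (tape_value ta))"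
  proof (rule Suc.IH)
    show "(g(p := 1)) (p - 1 - int i) = 2" if "i < j" for i
      using Suc.prems(1)[of "Suc i"] that by (simp add: algebra_simps)
    show "(g(p := 1)) (p - 1 - int j) = 3"
      using Suc.prems(2) by (simp add: algebra_simps)
  qed
  moreover have "g p = 2" using Suc.prems(1)[of 0] by simp
  ultimately show ?case
    by (auto simp del: fun_upd_apply intro!: estimates_delta)
qed

lemma estimates_ret:
  assumes "\<And>i. i < j \<Longrightarrow> g (p + int i) \<noteq> 3"
    and "estimates A (conf2 b (Ret b) tx tr (g, p + int j) w ts) T D"
  shows "estimates A (conf2 b (Ret b) tx tr (g, p) w ts) (T + j) D"
  using assms
proof (induction j arbitrary: p)
  case (Suc j)
  have "estimates A (conf2 b (Ret b) tx tr (g, p + 1) w ts) (T + j) D"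
  proof (rule Suc.IH)
    show "g (p + 1 + int i) \<noteq> 3" if "i < j" for i
      using Suc.prems(1)[of "Suc i"] that by (simp add: algebra_simps)
    show "estimates A (conf2 b (Ret b) tx tr (g, p + 1 + int j) w ts) T D"
      using Suc.prems(2) by (simp add: algebra_simps)
  qed
  moreover have "g p \<noteq> 3" using Suc.prems(1)[of 0] by simp
  ultimately have "estimates A (conf2 b (Ret b) tx tr (g, p) w ts) (Suc (T + j)) D"
    by (cases b) (auto simp: conf2_def intro!: estimates_delta)
  then show ?case by simp
qed simp

text \<open>All tapes are swept in parallel, each waiting on a blank once it is finished. The
  continuation must cope with arbitrary blank tapes, which is what discards the head
  positions.\<close>

lemma estimates_sweepR:
  assumes "\<And>t. t \<in> set ts \<Longrightarrow> nonblank_from t n"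
    and "\<And>ts'. length ts' = length ts \<Longrightarrow> (\<And>t. t \<in> set ts' \<Longrightarrow> fst t = (\<lambda>_. 0)) \<Longrightarrow>
      estimates A (conf (if b then Carry True else Ret True) tx tr ta tn ts') T D"
  shows "estimates A (conf (SweepR b) tx tr ta tn ts) (T + n + 1) D"
  using assms
proof (induction n arbitrary: ts)
  case 0
  then have "set (map scan ts) \<subseteq> {0}"
    by (auto simp: nonblank_from_def scan_def)
  moreover have "estimates A (conf (if b then Carry True else Ret True) tx tr ta tn ts) T D"
    using nonblank_from_scan_0[OF 0(1)] calculation by (intro 0(2)) auto
  ultimately have "estimates A (conf (SweepR b) tx tr ta tn ts) (Suc T) D"
    by (auto intro!: estimates_delta)
  then show ?case by simp
next
  case (Suc n)
  show ?case
  proof (cases "set (map scan ts) \<subseteq> {0}")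
    case True
    have "fst t = (\<lambda>_. 0)" if "t \<in> set ts" for t
      using nonblank_from_scan_0[OF Suc.prems(1)[OF that]] True that by auto
    then have "estimates A (conf (if b then Carry True else Ret True) tx tr ta tn ts) T D"
      by (intro Suc.prems(2)) auto
    with True have "estimates A (conf (SweepR b) tx tr ta tn ts) (Suc T) D"
      by (auto intro!: estimates_delta)
    then show ?thesis by (rule estimates_mono) simp
  next
    case False
    let ?ts = "map (\<lambda>t. write_move (0, if scan t = 0 then Stay else MoveR) t) ts"
    have "estimates A (conf (SweepR b) tx tr ta tn ?ts) (T + n + 1) D"
    proof (rule Suc.IH)
      show "nonblank_from t n" if t: "t \<in> set ?ts" for t
        using t nonblank_from_erase[OF Suc.prems(1)] by fastforce
    qed (rule Suc.prems(2); simp)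
    then have "estimates A (conf (SweepR b) tx tr ta tn ts) (Suc (T + n + 1)) D"
      using False
      by (intro estimates_delta[where ws = "(scan tx, Stay) # (scan tr, Stay) # (scan ta, Stay) # (scan tn, Stay) #
             map (\<lambda>s. (0, if s = 0 then Stay else MoveR)) (map scan ts)" and s' = "SweepR b"])
        (simp_all only: map2_map_scan delta.simps reachable.simps if_False list.map zip_Cons_Cons prod.case write_move_stay)
    then show ?thesis by simp
  qed
qed

lemma estimates_sweepL:
  assumes "\<And>t. t \<in> set ts \<Longrightarrow> nonblank_around t u n"
    and "\<And>ts'. length ts' = length ts \<Longrightarrow> (\<And>t. t \<in> set ts' \<Longrightarrow> nonblank_from t u) \<Longrightarrow>
      estimates A (conf (SweepR b) tx tr ta tn ts') T D"
  shows "estimates A (conf (SweepL b) tx tr ta tn ts) (T + n + 1) D"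
  using assms
proof (induction n arbitrary: ts)
  case blank: 0
  have z: "scan t = 0" if "t \<in> set ts" for t
    using nonblank_around_0[OF blank(1)[OF that]] .
  have "nonblank_from (write_move (scan t, MoveR) t) u" if "t \<in> set ts" for t
    using nonblank_around_scan_0[OF blank(1)[OF that] z[OF that]] by (simp add: write_move_scan)
  then have "estimates A (conf (SweepR b) tx tr ta tn (map (\<lambda>t. write_move (scan t, MoveR) t) ts)) T D"
    by (intro blank(2)) auto
  moreover have "set (map scan ts) \<subseteq> {0}" using z by auto
  ultimately have "estimates A (conf (SweepL b) tx tr ta tn ts) (Suc T) D"
      by (intro estimates_delta[where ws = "(scan tx, Stay) # (scan tr, Stay) # (scan ta, Stay) # (scan tn, Stay) #
             map (\<lambda>s. (s, MoveR)) (map scan ts)" and s' = "SweepR b"])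
        (simp_all only: map2_map_scan delta.simps reachable.simps if_True list.map zip_Cons_Cons prod.case write_move_stay)
  then show ?case by simp
next
  case (Suc n)
  show ?case
  proof (cases "set (map scan ts) \<subseteq> {0}")
    case True
    then have z: "scan t = 0" if "t \<in> set ts" for t using that by auto
    have "nonblank_from (write_move (scan t, MoveR) t) u" if "t \<in> set ts" for t
      using nonblank_around_scan_0[OF Suc.prems(1)[OF that] z[OF that]] by (simp add: write_move_scan)
    then have "estimates A (conf (SweepR b) tx tr ta tn (map (\<lambda>t. write_move (scan t, MoveR) t) ts)) T D"
      by (intro Suc.prems(2)) auto
    with True have "estimates A (conf (SweepL b) tx tr ta tn ts) (Suc T) D"
      by (intro estimates_delta[where ws = "(scan tx, Stay) # (scan tr, Stay) # (scan ta, Stay) # (scan tn, Stay) #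
             map (\<lambda>s. (s, MoveR)) (map scan ts)" and s' = "SweepR b"])
        (simp_all only: map2_map_scan delta.simps reachable.simps if_True list.map zip_Cons_Cons prod.case write_move_stay)
    then show ?thesis by (rule estimates_mono) simp
  next
    case False
    let ?ts = "map (\<lambda>t. write_move (scan t, if scan t = 0 then Stay else MoveL) t) ts"
    have "estimates A (conf (SweepL b) tx tr ta tn ?ts) (T + n + 1) D"
    proof (rule Suc.IH)
      show "nonblank_around t u n" if t: "t \<in> set ?ts" for t
        using t nonblank_around_left[OF Suc.prems(1)] by fastforce
    qed (rule Suc.prems(2); simp)
    then have "estimates A (conf (SweepL b) tx tr ta tn ts) (Suc (T + n + 1)) D"
      using False
      by (intro estimates_delta[where ws = "(scan tx, Stay) # (scan tr, Stay) # (scan ta, Stay) # (scan tn, Stay) #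
             map (\<lambda>s. (s, if s = 0 then Stay else MoveL)) (map scan ts)" and s' = "SweepL b"])
        (simp_all only: map2_map_scan delta.simps reachable.simps if_False list.map zip_Cons_Cons prod.case write_move_stay)
    then show ?thesis by simp
  qed
qed

section \<open>Step-by-step simulation of \<open>M\<close>\<close>

text \<open>\<open>o'\<close> is the translation caused by heads that are not returned between
  samples. The nonblank cells form an interval of length at most \<open>u\<close>, and the head is
  inside it or adjacent to it on either side.\<close>

definition sim_tape :: "nat \<Rightarrow> tape \<Rightarrow> tape \<Rightarrow> bool" where
  "sim_tape u t t' \<longleftrightarrow> (\<exists>o' a b. snd t' = snd t + o' \<and> (\<forall>i. dec (fst t' (i + o')) = fst t i) \<and>
     (\<forall>i. fst t' i \<noteq> 0 \<longleftrightarrow> a \<le> i \<and> i < b) \<and> a - 1 \<le> snd t' \<and> snd t' \<le> b \<and> a \<le> b \<and> b - a \<le> int u)"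

lemma enc_neq_0: "enc s \<noteq> 0"
  using M_bounds by (simp add: enc_def)

lemma dec_enc: "s < num_syms M \<Longrightarrow> dec (enc s) = s"
  by (simp add: enc_def dec_def)

lemma sim_tape_mono: "sim_tape u t t' \<Longrightarrow> u \<le> u' \<Longrightarrow> sim_tape u' t t'"
  unfolding sim_tape_def by (elim exE conjE, intro exI conjI) (assumption | linarith)+

lemma sim_tape_scan: "sim_tape u t t' \<Longrightarrow> dec (scan t') = scan t"
  unfolding sim_tape_def scan_def by (elim exE conjE) simp

lemma sim_tape_write:
  assumes "sim_tape u t t'" "s < num_syms M"
  shows "sim_tape (Suc u) (write_move (s, d) t) (write_move (enc s, d) t')"
proof -
  from assms(1) obtain o' a b where *: "snd t' = snd t + o'" "\<forall>i. dec (fst t' (i + o')) = fst t i"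
    "\<And>i. fst t' i \<noteq> 0 \<longleftrightarrow> a \<le> i \<and> i < b" "a - 1 \<le> snd t'" "snd t' \<le> b" "a \<le> b" "b - a \<le> int u"
    unfolding sim_tape_def by blast
  obtain a' b' where ab: "\<forall>i. ((fst t')(snd t' := enc s)) i \<noteq> 0 \<longleftrightarrow> a' \<le> i \<and> i < b'" "a' \<le> snd t'"
    "snd t' < b'" "b' - a' \<le> int (Suc u)"
    by (rule interval_insert[OF *(3-7) enc_neq_0[of s]])
  have "-1 \<le> shift d" "shift d \<le> 1" by (cases d; simp)+
  moreover have "dec (((fst t')(snd t' := enc s)) (i + o')) = ((fst t)(snd t := s)) i" for i
    using *(1,2) dec_enc[OF assms(2)] by simp
  ultimately show ?thesis
    unfolding sim_tape_def
    using ab *(1) by (intro exI[of _ o'] exI[of _ a'] exI[of _ b']) (simp add: write_move_def del: fun_upd_apply)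
qed

text \<open>Before marking, the head may be on a fresh blank just to the right of the interval,
  where a sweep to the left would stop immediately; marking its cell puts the head inside, at the
  price of one more cell.\<close>

lemma sim_tape_mark:
  assumes "sim_tape u t t'"
  shows "nonblank_around (write_move (enc (scan t'), Stay) t') (Suc u) (Suc u)"
proof -
  from assms obtain a b where *:
    "\<And>i. fst t' i \<noteq> 0 \<longleftrightarrow> a \<le> i \<and> i < b" "a - 1 \<le> snd t'" "snd t' \<le> b" "a \<le> b" "b - a \<le> int u"
    unfolding sim_tape_def by blast
  obtain a' b' where ab: "\<forall>i. ((fst t')(snd t' := enc (scan t'))) i \<noteq> 0 \<longleftrightarrow> a' \<le> i \<and> i < b'" "a' \<le> snd t'"
    "snd t' < b'" "b' - a' \<le> int (Suc u)"
    by (rule interval_insert[OF *(1-5) enc_neq_0[of "scan t'"]])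
  then show ?thesis
    unfolding nonblank_around_def
    by (intro exI[of _ a'] exI[of _ b']) (simp add: write_move_def del: fun_upd_apply)
qed

lemma sim_tapes_scan: "list_all2 (sim_tape u) mts ts \<Longrightarrow> map dec (map scan ts) = map scan mts"
  by (induction rule: list_all2_induct) (auto simp: sim_tape_scan)

lemma sim_tapes_write:
  assumes "list_all2 (sim_tape u) mts ts" "length ws = length mts" "\<forall>(s, d) \<in> set ws. s < num_syms M"
  shows "list_all2 (sim_tape (Suc u)) (map2 write_move ws mts) (map2 write_move (map (apfst enc) ws) ts)"
  using assms
proof (induction arbitrary: ws rule: list_all2_induct)
  case (Cons t mts t' ts)
  then obtain s d ws' where ws: "ws = (s, d) # ws'" by (cases ws) auto
  with Cons show ?case by (auto intro: sim_tape_write)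
qed simp

text \<open>The run of \<open>M\<close> with fair coins is exactly \<open>descent\<close>, so it
  suffices to know the law \<open>K\<close> of the output as a function of the score. Each step of
  \<open>M\<close> costs one step here and enlarges the visited interval by at most one cell, whence
  \<open>u + t\<close> at the leaves.\<close>

lemma estimates_sim:
  assumes "halts_within M c t" "valid_config M c" "list_all2 (sim_tape u) (snd c) ts"
    and "\<And>c' d' b' ts'. succs M c' = [] \<Longrightarrow> valid_config M c' \<Longrightarrow> d' \<le> d + t \<Longrightarrow>
      list_all2 (sim_tape (u + t)) (snd c') ts' \<Longrightarrow>
      estimates A (conf (Sim (fst c') b') tx tr (g, h - int d') tn ts') T (K (if b' then 2 ^ d' else 0))"
  shows "estimates A (conf (Sim (fst c) b) tx tr (g, h - int d) tn ts) (T + t) (bind_pmf (descent M t d b c) K)"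
  using assms
proof (induction t arbitrary: c u ts d b)
  case 0
  then show ?case by (simp add: halts_within_0 bind_return_pmf)
next
  case (Suc t)
  note sim = Suc.prems(3)
  have sc: "map dec (map scan ts) = map scan (snd c)" by (rule sim_tapes_scan[OF sim])
  have q: "fst c < num_states M" using Suc.prems(2) by (simp add: valid_config_def)
  have next_sim: "list_all2 (sim_tape (Suc u)) (snd (perform (q', ws) c)) (map2 write_move (map (apfst enc) ws) ts)"
    if "(q', ws) \<in> set (trans M (fst c) (map scan (snd c)))" for q' ws
    using valid_trans(2,3)[OF wf Suc.prems(2) that] Suc.prems(2)
    by (auto simp: perform_def valid_config_def intro!: sim_tapes_write[OF sim])
  have IH: "estimates A (conf (Sim (fst c') b') tx tr (g, h - int d') tn ts') (T + t)
      (bind_pmf (descent M t d' b' c') K)"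
    if c': "c' \<in> set (succs M c)" and ts': "list_all2 (sim_tape (Suc u)) (snd c') ts'" and d': "d' \<le> Suc d" for c' b' d' ts'
  proof (rule Suc.IH[OF _ _ ts'])
    from c' obtain k where "k < length (succs M c)" "c' = succs M c ! k" by (metis in_set_conv_nth)
    then show "halts_within M c' t" using halts_within_succ[OF Suc.prems(1)] by simp
    show "valid_config M c'" by (rule valid_succs[OF wf Suc.prems(2) c'])
  qed (rule Suc.prems(4); use d' in simp)
  show ?case
    using length_succs_binary[OF bin Suc.prems(2)]
  proof (cases rule: length_le_2_cases)
    case 1
    have "list_all2 (sim_tape (u + Suc t)) (snd c) ts"
      using sim by (rule list_all2_mono) (auto intro: sim_tape_mono)
    from Suc.prems(4)[OF 1 Suc.prems(2) _ this, of d b] show ?thesis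
      using 1 estimates_mono[of A _ T _ "T + Suc t"] by (simp add: bind_return_pmf)
  next
    case (2 c')
    then obtain q' ws where tr: "trans M (fst c) (map scan (snd c)) = [(q', ws)]" and c': "c' = perform (q', ws) c"
      by (auto simp: succs_def map_eq_Cons_conv)
    have "estimates A (conf (Sim (fst c') b) tx tr (g, h - int d) tn (map2 write_move (map (apfst enc) ws) ts))
        (T + t) (bind_pmf (descent M t d b c') K)"
      by (rule IH[OF _ next_sim[of q' ws, folded c']]) (use 2 tr in simp_all)
    then have "estimates A (conf (Sim (fst c) b) tx tr (g, h - int d) tn ts) (Suc (T + t))
       (bind_pmf (descent M t d b c') K)"
      using q tr sc c'
      by (intro estimates_delta[where s' = "Sim q' b" and
          ws = "(scan tx, Stay) # (scan tr, Stay) # (g (h - int d), Stay) # (scan tn, Stay) # map (apfst enc) ws"])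
        (simp_all add: perform_def del: map_map)
    then show ?thesis using 2 by simp
  next
    case (3 c0 c1)
    then obtain q0 ws0 q1 ws1 where tr: "trans M (fst c) (map scan (snd c)) = [(q0, ws0), (q1, ws1)]"
      and c': "c0 = perform (q0, ws0) c" "c1 = perform (q1, ws1) c"
      by (auto simp: succs_def map_eq_Cons_conv)
    have e0: "estimates A (conf (Sim (fst c0) b) tx tr (g, h - int (Suc d)) tn (map2 write_move (map (apfst enc) ws0) ts))
        (T + t) (bind_pmf (descent M t (Suc d) b c0) K)"
      by (rule IH[OF _ next_sim[of q0 ws0, folded c'(1)]]) (use 3 tr in simp_all)
    have e1: "estimates A (conf (Sim (fst c1) True) tx tr (g, h - int (Suc d)) tn (map2 write_move (map (apfst enc) ws1) ts))
        (T + t) (bind_pmf (descent M t (Suc d) True c1) K)"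
      by (rule IH[OF _ next_sim[of q1 ws1, folded c'(2)]]) (use 3 tr in simp_all)
    let ?D = "\<lambda>k. bind_pmf (descent M t (Suc d) (b \<or> k = 1) (succs M c ! k)) K"
    have "succs A (conf (Sim (fst c) b) tx tr (g, h - int d) tn ts) =
      [conf (Sim (fst c0) b) tx tr (g, h - int (Suc d)) tn (map2 write_move (map (apfst enc) ws0) ts),
       conf (Sim (fst c1) True) tx tr (g, h - int (Suc d)) tn (map2 write_move (map (apfst enc) ws1) ts)]"
      using q tr sc c' by (simp add: succs_sampling_machine perform_def algebra_simps del: map_map)
    from estimates_coin[OF this, of "T + t" ?D] e0 e1 3
    have "estimates A (conf (Sim (fst c) b) tx tr (g, h - int d) tn ts) (Suc (T + t))
        (bind_pmf (pmf_of_set {..<2}) ?D)" by simp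
    then show ?thesis using 3 by (simp add: bind_assoc_pmf)
  qed
qed

section \<open>Scoring a leaf, counting it and cleaning up\<close>

text \<open>A carry over \<open>j\<close> cells takes \<open>j\<close> moves to the left and
  \<open>j\<close> more on the way back, and it lowers the number of ones by \<open>j - 1\<close>;
  hence the potential \<open>2 * card (ones ga)\<close> pays for it up to a constant. The term
  \<open>d\<close> is the way back from the scored cell to the marker.\<close>

lemma estimates_add:
  assumes "accumulator L ga" and "\<And>ga'. accumulator L ga' \<Longrightarrow> binval ga' = binval ga + (if b then 2 ^ d else 0) / 2 ^ L \<Longrightarrow>
      estimates A (conf (Carry False) tx tr (ga', int L + 1) (gn, pn - 1) ts) (T + 2 * card (ones ga')) D"
  shows "estimates A (conf (if b then Carry True else Ret True) tx tr (ga, int L - int d) (gn, pn) ts)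
    (T + 2 * card (ones ga) + d + 5) D"
proof -
  have ret: "estimates A (conf (Ret True) tx tr (ga', int L - int d - int j) (gn, pn) ts) (T' + d + j + 2) D"
    if "accumulator L ga'" "estimates A (conf (Carry False) tx tr (ga', int L + 1) (gn, pn - 1) ts) T' D" for ga' j T'
  proof -
    have "estimates A (conf (Ret True) tx tr (ga', int L + 1) (gn, pn) ts) (Suc T') D"
      using that by (auto simp: accumulator_def fun_upd_idem intro!: estimates_delta)
    then have "estimates A (conf2 True (Ret True) tx tr (ga', int L - int d - int j) (gn, pn) ts) (Suc T' + (d + j + 1)) D"
      using that(1) by (intro estimates_ret) (auto simp: conf2_def accumulator_def)
    then show ?thesis by (simp add: conf2_def add.assoc)
  qed
  show ?thesis
  \<comment> \<open>On the leftmost leaf nothing is added, but the head of tape 2 must still return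
    to its marker.\<close>
  proof (cases b)
    case False
    have "estimates A (conf (Ret True) tx tr (ga, int L - int d - int 0) (gn, pn) ts) (T + 2 * card (ones ga) + d + 0 + 2) D"
      using False assms(2)[OF assms(1)] by (intro ret[OF assms(1)]) simp
    from estimates_mono[OF this, of "T + 2 * card (ones ga) + d + 5"] False show ?thesis by simp
  next
    case True
    have fin: "finite (ones ga)" using assms(1) by (simp add: accumulator_def)
    obtain j where j: "\<And>i. i < j \<Longrightarrow> ga (int L - int d - int i) = 2" "ga (int L - int d - int j) \<noteq> 2"
      using ex_carry_position[OF fin] by blast
    let ?g = "carry j ga (int L - int d)"
    have acc: "accumulator L ?g" by (rule accumulator_carry[OF assms(1) _ j]) auto
    have v: "binval ?g = binval ga + 2 ^ d / 2 ^ L" "card (ones ?g) + j = card (ones ga) + 1"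
      using carry_add[OF fin j] power_int_diff_nat[of L d] by auto
    have "estimates A (conf2 True (Ret True) tx tr (?g, int L - int d - int j) (gn, pn) ts)
        (T + 2 * card (ones ?g) + d + j + 2) D"
      using True assms(2)[OF acc] v(1) ret[OF acc] by (simp add: conf2_def)
    then have "estimates A (conf2 True (Carry True) tx tr (ga, int L - int d) (gn, pn) ts)
        (T + 2 * card (ones ?g) + d + j + 2 + j + 1) D"
      using j assms(1) by (intro estimates_carry) (auto simp: accumulator_def)
    from estimates_mono[OF this, of "T + 2 * card (ones ga) + d + 5"] show ?thesis
      using True v(2) by (simp add: conf2_def)
  qed
qed

text \<open>The carry reaches the marker in cell 0 exactly when all \<open>L\<close> digits are 1,
  that is, when the present sample is the last one. In that case its \<open>L\<close> steps are
  covered by the potential, as there are \<open>L\<close> ones.\<close>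

lemma estimates_count:
  assumes "counter L gn" "binval gn = 1 - real (Suc r) * 2 powi (- int L)"
    and "r = 0 \<Longrightarrow> D = return_pmf (tape_value ta)"
    and "\<And>gn'. r \<noteq> 0 \<Longrightarrow> counter L gn' \<Longrightarrow> binval gn' = 1 - real r * 2 powi (- int L) \<Longrightarrow>
      estimates A (conf Copy tx tr ta (gn', int L + 1) ts) (T + 2 * card (ones gn')) D"
  shows "estimates A (conf (Carry False) tx tr ta (gn, int L) ts) (T + 2 * card (ones gn) + 5) D"
proof -
  have fin: "finite (ones gn)" using assms(1) by (auto simp: counter_def intro: finite_subset)
  obtain j where j: "\<And>i. i < j \<Longrightarrow> gn (int L - int i) = 2" "gn (int L - int j) \<noteq> 2"
    using ex_carry_position[OF fin] by blast
  have "j \<le> L"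
  proof (rule ccontr)
    assume "\<not> j \<le> L"
    then have "gn 0 = 2" using j(1)[of L] by simp
    with assms(1) show False by (simp add: counter_def)
  qed
  show ?thesis
  proof (cases "j = L")
    case True
    have "{1..int L} \<subseteq> ones gn"
    proof
      fix i assume "i \<in> {1..int L}"
      then show "i \<in> ones gn" using j(1)[of "L - nat i"] True by (auto simp: ones_def of_nat_diff)
    qed
    with assms(1) have o: "ones gn = {1..int L}" by (auto simp: counter_def)
    with counter_full[OF assms(1,2)] have "r = 0" by simp
    have "estimates A (conf (Carry False) tx tr ta (gn, int L) ts) L (return_pmf (tape_value ta))"
      using j(1) True assms(1) by (intro estimates_overflow) (auto simp: counter_def)
    from estimates_mono[OF this, of "T + 2 * card (ones gn) + 5"] assms(3)[OF \<open>r = 0\<close>] o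
    show ?thesis by simp
  next
    case False
    with \<open>j \<le> L\<close> have "j < L" by simp
    then have "int L - int j \<in> {1..int L}" by auto
    moreover have "int L - int j \<notin> ones gn" using j(2) by (simp add: ones_def)
    ultimately have "ones gn \<noteq> {1..int L}" by metis
    with counter_full[OF assms(1,2)] have "r \<noteq> 0" by simp
    let ?g = "carry j gn (int L)"
    have c: "counter L ?g" by (rule counter_carry[OF assms(1) \<open>j < L\<close> j])
    have v: "binval ?g = 1 - real r * 2 powi (- int L)" "card (ones ?g) + j = card (ones gn) + 1"
      using carry_add[OF fin j] assms(2) by (auto simp: algebra_simps)
    have "estimates A (conf Copy tx tr ta (?g, int L + 1) ts) (T + 2 * card (ones ?g)) D"
      by (rule assms(4)[OF \<open>r \<noteq> 0\<close> c v(1)])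
    then have "estimates A (conf (Ret False) tx tr ta (?g, int L + 1) ts) (Suc (T + 2 * card (ones ?g))) D"
      using c by (auto simp: counter_def fun_upd_idem intro!: estimates_delta)
    then have "estimates A (conf2 False (Ret False) tx tr (?g, int L - int j) ta ts) (Suc (T + 2 * card (ones ?g)) + (j + 1)) D"
      using c \<open>j < L\<close> by (intro estimates_ret) (auto simp: conf2_def counter_def)
    then have "estimates A (conf2 False (Carry False) tx tr (gn, int L) ta ts) (Suc (T + 2 * card (ones ?g)) + (j + 1) + j + 1) D"
      using j assms(1) \<open>j < L\<close> by (intro estimates_carry) (auto simp: counter_def)
    from estimates_mono[OF this, of "T + 2 * card (ones gn) + 5"] show ?thesis
      using v(2) by (simp add: conf2_def)
  qed
qed

text \<open>Apart from the two potentials, the cost is that of two sweeps over an interval of length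
  at most \<open>Suc u\<close> and of a return over \<open>d\<close> cells, so it does not depend on
  \<open>L\<close>.\<close>

lemma estimates_leaf:
  assumes "accumulator L ga" "counter L gn" "binval gn = 1 - real (Suc r) * 2 powi (- int L)"
    and halted: "succs M c = []" "valid_config M c" and sim: "list_all2 (sim_tape u) (snd c) ts"
    and last: "r = 0 \<Longrightarrow> D = return_pmf (binval ga + (if b then 2 ^ d else 0) / 2 ^ L)"
    and cont: "\<And>ga' gn' ts'. r \<noteq> 0 \<Longrightarrow> accumulator L ga' \<Longrightarrow>
      binval ga' = binval ga + (if b then 2 ^ d else 0) / 2 ^ L \<Longrightarrow> counter L gn' \<Longrightarrow>
      binval gn' = 1 - real r * 2 powi (- int L) \<Longrightarrow> length ts' = num_tapes M \<Longrightarrow>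
      (\<And>t. t \<in> set ts' \<Longrightarrow> fst t = (\<lambda>_. 0)) \<Longrightarrow>
      estimates A (conf Copy tx tr (ga', int L + 1) (gn', int L + 1) ts')
        (T + 2 * card (ones ga') + 2 * card (ones gn')) D"
  shows "estimates A (conf (Sim (fst c) b) tx tr (ga, int L + 1 - int d) (gn, int L + 1) ts)
    (T + 2 * card (ones ga) + 2 * card (ones gn) + 2 * u + d + 20) D"
proof -
  let ?T = "T + 2 * card (ones gn) + 5"
  let ?T1 = "?T + 2 * card (ones ga) + d + 5"
  have len: "length ts = num_tapes M"
    using list_all2_lengthD[OF sim] halted(2) by (simp add: valid_config_def)
  have add: "estimates A (conf (if b then Carry True else Ret True) tx tr (ga, int L - int d) (gn, int L + 1) ts') ?T1 D"
    if ts': "length ts' = num_tapes M" "\<And>t. t \<in> set ts' \<Longrightarrow> fst t = (\<lambda>_. 0)" for ts'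
  proof (rule estimates_add[OF assms(1)])
    fix ga' assume ga': "accumulator L ga'" "binval ga' = binval ga + (if b then 2 ^ d else 0) / 2 ^ L"
    have "estimates A (conf (Carry False) tx tr (ga', int L + 1) (gn, int L) ts')
        (T + 2 * card (ones ga') + 2 * card (ones gn) + 5) D"
    proof (rule estimates_count[OF assms(2,3)])
      show "D = return_pmf (tape_value (ga', int L + 1))" if "r = 0"
        using last[OF that] ga'(2) by (simp add: tape_value_eq_binval)
      show "estimates A (conf Copy tx tr (ga', int L + 1) (gn', int L + 1) ts')
          (T + 2 * card (ones ga') + 2 * card (ones gn')) D"
        if "r \<noteq> 0" "counter L gn'" "binval gn' = 1 - real r * 2 powi (- int L)" for gn'
        by (rule cont[OF that(1) ga' that(2,3) ts'])
    qed
    then show "estimates A (conf (Carry False) tx tr (ga', int L + 1) (gn, int L + 1 - 1) ts')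
        (?T + 2 * card (ones ga')) D" by (simp add: algebra_simps)
  qed
  have sweepR: "estimates A (conf (SweepR b) tx tr (ga, int L - int d) (gn, int L + 1) ts') (?T1 + Suc u + 1) D"
    if "length ts' = num_tapes M" "\<And>t. t \<in> set ts' \<Longrightarrow> nonblank_from t (Suc u)" for ts'
    by (rule estimates_sweepR[OF that(2)], assumption, rule add) (use that(1) in simp_all)
  let ?ts = "map (\<lambda>t. write_move (enc (scan t), Stay) t) ts"
  have around: "nonblank_around t (Suc u) (Suc u)" if t: "t \<in> set ?ts" for t
  proof -
    from t obtain t0 where t0: "t0 \<in> set ts" "t = write_move (enc (scan t0), Stay) t0" by auto
    from t0(1) obtain i where "i < length ts" "ts ! i = t0" by (auto simp: in_set_conv_nth)
    with list_all2_nthD2[OF sim, of i] have "sim_tape u (snd c ! i) t0" by simp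
    from sim_tape_mark[OF this] show ?thesis by (simp add: t0(2))
  qed
  have "estimates A (conf (SweepL b) tx tr (ga, int L - int d) (gn, int L + 1) ?ts)
      (?T1 + Suc u + 1 + Suc u + 1) D"
    by (rule estimates_sweepL[OF around], assumption, rule sweepR) (use len in simp_all)
  moreover have "trans M (fst c) (map dec (map scan ts)) = []"
    using halted(1) sim_tapes_scan[OF sim] by (simp add: succs_def del: map_map)
  moreover have "fst c < num_states M" using halted(2) by (simp add: valid_config_def)
  ultimately have "estimates A (conf (Sim (fst c) b) tx tr (ga, int L + 1 - int d) (gn, int L + 1) ts)
      (Suc (?T1 + Suc u + 1 + Suc u + 1)) D"
    by (intro estimates_delta[where s' = "SweepL b" and ws = "(scan tx, Stay) # (scan tr, Stay) #
          (ga (int L + 1 - int d), MoveL) # (scan (gn, int L + 1), Stay) # map (\<lambda>s. (enc s, Stay)) (map scan ts)"])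
      (simp_all add: map2_map_scan del: map_map)
  from estimates_mono[OF this, of "T + 2 * card (ones ga) + 2 * card (ones gn) + 2 * u + d + 20"]
  show ?thesis by simp
qed

lemma estimates_rewind:
  assumes "\<And>i. X i \<noteq> 0 \<longleftrightarrow> 0 \<le> i \<and> i < int n" "k \<le> n"
    and "estimates A (conf (Sim 0 False) (X, 0) tr ta tn ((Y, p) # ts)) T D"
  shows "estimates A (conf Rewind (X, int k - 1) tr ta tn ((Y, p + int k - 1) # ts)) (T + k + 1) D"
  using assms(2)
proof (induction k)
  case 0
  have "X (-1) = 0" using assms(1)[of "-1"] by auto
  then have "estimates A (conf Rewind (X, -1) tr ta tn ((Y, p - 1) # ts)) (Suc T) D"
    using assms(3) M_bounds by (auto simp: fun_upd_idem intro!: estimates_delta)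
  then show ?case by simp
next
  case (Suc k)
  have "X (int k) \<noteq> 0" using assms(1)[of "int k"] Suc.prems by auto
  moreover have "estimates A (conf Rewind (X, int k - 1) tr ta tn ((Y, p + int k - 1) # ts)) (T + k + 1) D"
    using Suc by simp
  ultimately have "estimates A (conf Rewind (X, int k) tr ta tn ((Y, p + int k) # ts)) (Suc (T + k + 1)) D"
    by (auto intro!: estimates_delta)
  then show ?case by (simp add: algebra_simps)
qed

text \<open>Bits are nonblank symbols, so blanks delimit the input on both sides. The copy starts
  wherever the head of tape 4 was left, whence the arbitrary \<open>p\<close>.\<close>

lemma estimates_copy:
  assumes X: "\<And>i. X i \<noteq> 0 \<longleftrightarrow> 0 \<le> i \<and> i < int n"
    and "estimates A (conf (Sim 0 False) (X, 0) tr ta tn ((\<lambda>i. X (i - p), p) # ts)) T D"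
  shows "estimates A (conf Copy (X, 0) tr ta tn ((\<lambda>_. 0, p) # ts)) (T + 2 * n + 2) D"
proof -
  \<comment> \<open>The copy after \<open>k\<close> symbols.\<close>
  let ?Y = "\<lambda>k j. if j < p + int k then X (j - p) else 0"
  have "estimates A (conf Copy (X, int k) tr ta tn ((?Y k, p + int k) # ts)) (T + n + 2 + (n - k)) D" if "k \<le> n" for k
    using that
  proof (induction k rule: inc_induct)
    case base
    have "?Y n = (\<lambda>i. X (i - p))"
    proof
      fix j show "?Y n j = X (j - p)" using X[of "j - p"] by (cases "j < p + int n") auto
    qed
    moreover have "estimates A (conf Rewind (X, int n - 1) tr ta tn ((\<lambda>i. X (i - p), p + int n - 1) # ts)) (T + n + 1) D"
      by (rule estimates_rewind[OF X order_refl assms(2)])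
    moreover have "X (int n) = 0" using X[of "int n"] by auto
    ultimately have "estimates A (conf Copy (X, int n) tr ta tn ((?Y n, p + int n) # ts)) (Suc (T + n + 1)) D"
      by (auto simp: fun_upd_idem intro!: estimates_delta)
    then show ?case by simp
  next
    case (step k)
    have "X (int k) \<noteq> 0" using X[of "int k"] step.hyps by auto
    moreover have "(?Y k)(p + int k := X (int k)) = ?Y (Suc k)"
      by (auto simp: fun_eq_iff)
    moreover have "estimates A (conf Copy (X, int k + 1) tr ta tn ((?Y (Suc k), p + int k + 1) # ts)) (T + n + 2 + (n - Suc k)) D"
      using step.IH by (simp add: algebra_simps)
    ultimately have "estimates A (conf Copy (X, int k) tr ta tn ((?Y k, p + int k) # ts)) (Suc (T + n + 2 + (n - Suc k))) D"
      by (intro estimates_delta[where s' = Copy and ws = "(X (int k), MoveR) # (scan tr, Stay) # (scan ta, Stay) #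
          (scan tn, Stay) # (X (int k), MoveR) # stay (map scan ts)"]) (simp_all del: fun_upd_apply of_nat_Suc)
    then show ?case using step.hyps by (simp add: Suc_diff_Suc)
  qed
  from this[of 0] have "estimates A (conf Copy (X, 0) tr ta tn ((?Y 0, p) # ts)) (T + 2 * n + 2) D"
    by (simp add: mult_2 add.assoc)
  moreover have "?Y 0 = (\<lambda>_. 0)"
  proof
    fix j show "?Y 0 j = 0" using X[of "j - p"] by auto
  qed
  ultimately show ?thesis by simp
qed

lemma dec_string_tape: "dec (fst (string_tape x) i) = fst (string_tape x) i"
  using M_bounds by (auto simp: string_tape_def bit_sym_def dec_def)

text \<open>The translation is \<open>p\<close> on the first tape; on every other tape it is the
  position of its head, where the visited interval is still empty.\<close>

lemma sim_tapes_start: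
  assumes "length ts = num_tapes M - 1" "\<And>t. t \<in> set ts \<Longrightarrow> fst t = (\<lambda>_. 0)"
  shows "list_all2 (sim_tape (length x)) (snd (start M x)) ((\<lambda>i. fst (string_tape x) (i - p), p) # ts)"
proof -
  let ?X = "fst (string_tape x)"
  have "sim_tape (length x) (string_tape x) (\<lambda>i. ?X (i - p), p)"
    unfolding sim_tape_def
  proof (intro exI conjI allI)
    show "snd (\<lambda>i. ?X (i - p), p) = snd (string_tape x) + p" by (simp add: string_tape_def)
    show "dec (fst (\<lambda>i. ?X (i - p), p) (i + p)) = ?X i" for i by (simp add: dec_string_tape)
    show "fst (\<lambda>i. ?X (i - p), p) i \<noteq> 0 \<longleftrightarrow> p \<le> i \<and> i < p + int (length x)" for i
      using string_tape_nonblank[of x "i - p"] by auto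
  qed simp_all
  moreover have "sim_tape (length x) blank_tape t" if "t \<in> set ts" for t
    unfolding sim_tape_def
  proof (intro exI conjI allI)
    show "snd t = snd blank_tape + snd t" by (simp add: blank_tape_def)
    show "dec (fst t (i + snd t)) = fst blank_tape i" for i
      using assms(2)[OF that] by (simp add: blank_tape_def dec_def)
    show "fst t i \<noteq> 0 \<longleftrightarrow> snd t \<le> i \<and> i < snd t" for i
      using assms(2)[OF that] by simp
  qed simp_all
  then have "list_all2 (sim_tape (length x)) (replicate (num_tapes M - 1) blank_tape) ts"
    using assms(1) by (auto simp: list_all2_conv_all_nth)
  ultimately show ?thesis by (simp add: start_def initial_def)
qed

section \<open>The sampling loop\<close>

text \<open>The cost per sample adds up from copying and rewinding
  (\<open>2 * length x + 2\<close>), the descent (\<open>t\<close>), and the leaf with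
  \<open>u = length x + t\<close> and at most \<open>t\<close> branchings
  (\<open>2 * (length x + t) + t + 20\<close>).\<close>

lemma estimates_iteration:
  assumes halts: "halts_within M (start M x) t"
    and loop: "accumulator L ga" "counter L gn" "binval gn = 1 - real (Suc r) * 2 powi (- int L)"
    and ts: "length ts = num_tapes M" "\<And>t. t \<in> set ts \<Longrightarrow> fst t = (\<lambda>_. 0)"
    and last: "\<And>v. r = 0 \<Longrightarrow> K v = return_pmf (binval ga + v / 2 ^ L)"
    and cont: "\<And>v ga' gn' ts'. r \<noteq> 0 \<Longrightarrow> accumulator L ga' \<Longrightarrow> binval ga' = binval ga + v / 2 ^ L \<Longrightarrow>
      counter L gn' \<Longrightarrow> binval gn' = 1 - real r * 2 powi (- int L) \<Longrightarrow> length ts' = num_tapes M \<Longrightarrow>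
      (\<And>t. t \<in> set ts' \<Longrightarrow> fst t = (\<lambda>_. 0)) \<Longrightarrow>
      estimates A (conf Copy (string_tape x) tr (ga', int L + 1) (gn', int L + 1) ts')
        (T + 2 * card (ones ga') + 2 * card (ones gn')) (K v)"
  shows "estimates A (conf Copy (string_tape x) tr (ga, int L + 1) (gn, int L + 1) ts)
    (T + (4 * length x + 4 * t + 22) + 2 * card (ones ga) + 2 * card (ones gn))
    (bind_pmf (descent M t 0 False (start M x)) K)"
proof -
  let ?X = "fst (string_tape x)"
  let ?T = "T + 2 * card (ones ga) + 2 * card (ones gn) + 2 * (length x + t) + t + 20"
  have X: "string_tape x = (?X, 0)" by (simp add: string_tape_def)
  obtain t0 ts0 where ts0: "ts = t0 # ts0" using ts(1) M_bounds by (cases ts) auto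
  obtain p where p: "t0 = (\<lambda>_. 0, p)" using ts(2)[of t0] ts0 by (cases t0) auto
  have "length ts0 = num_tapes M - 1" "\<And>t. t \<in> set ts0 \<Longrightarrow> fst t = (\<lambda>_. 0)"
    using ts ts0 by simp_all
  note sim = sim_tapes_start[OF this, of x p]
  have "estimates A (conf (Sim (fst (start M x)) False) (string_tape x) tr (ga, int L + 1 - int 0) (gn, int L + 1)
      ((\<lambda>i. ?X (i - p), p) # ts0)) (?T + t) (bind_pmf (descent M t 0 False (start M x)) K)"
  proof (rule estimates_sim[OF halts valid_start[OF wf] sim])
    fix c' d' b' ts'
    assume c': "succs M c' = []" "valid_config M c'" "d' \<le> 0 + t"
      "list_all2 (sim_tape (length x + t)) (snd c') ts'"
    have "estimates A (conf (Sim (fst c') b') (string_tape x) tr (ga, int L + 1 - int d') (gn, int L + 1) ts')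
      (T + 2 * card (ones ga) + 2 * card (ones gn) + 2 * (length x + t) + d' + 20)
      (K (if b' then 2 ^ d' else 0))"
      by (rule estimates_leaf[OF loop c'(1,2,4) last cont])
    then show "estimates A (conf (Sim (fst c') b') (string_tape x) tr (ga, int L + 1 - int d') (gn, int L + 1) ts')
      ?T (K (if b' then 2 ^ d' else 0))"
      by (rule estimates_mono) (use \<open>d' \<le> 0 + t\<close> in simp)
  qed
  then have "estimates A (conf (Sim 0 False) (?X, 0) tr (ga, int L + 1) (gn, int L + 1)
      ((\<lambda>i. ?X (i - p), p) # ts0)) (?T + t) (bind_pmf (descent M t 0 False (start M x)) K)"
    by (simp add: X[symmetric] start_def initial_def)
  from estimates_copy[OF string_tape_nonblank this]
  have "estimates A (conf Copy (string_tape x) tr (ga, int L + 1) (gn, int L + 1) ts)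
      (?T + t + 2 * length x + 2) (bind_pmf (descent M t 0 False (start M x)) K)"
    by (simp only: X[symmetric] ts0 p)
  then show ?thesis by (rule estimates_mono) simp
qed

text \<open>The potentials telescope: those left after one sample are the initial ones of the next.
  An arbitrary initial content \<open>ga\<close> is needed for the induction over the samples still
  to be drawn.\<close>

lemma estimates_loop:
  assumes halts: "halts_within M (start M x) t"
    and "accumulator L ga" "counter L gn" "binval gn = 1 - real (Suc r) * 2 powi (- int L)"
    and "length ts = num_tapes M" "\<And>t. t \<in> set ts \<Longrightarrow> fst t = (\<lambda>_. 0)"
  shows "estimates A (conf Copy (string_tape x) tr (ga, int L + 1) (gn, int L + 1) ts)
    (Suc r * (4 * length x + 4 * t + 22) + 2 * card (ones ga) + 2 * card (ones gn))
    (map_pmf (\<lambda>w. binval ga + w / 2 ^ L) (sum_pmf (descent M t 0 False (start M x)) (Suc r)))"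
  using assms(2-)
proof (induction r arbitrary: ga gn ts)
  case 0
  let ?P = "descent M t 0 False (start M x)"
  have "estimates A (conf Copy (string_tape x) tr (ga, int L + 1) (gn, int L + 1) ts)
    (0 + (4 * length x + 4 * t + 22) + 2 * card (ones ga) + 2 * card (ones gn))
    (bind_pmf ?P (\<lambda>v. return_pmf (binval ga + v / 2 ^ L)))"
    by (rule estimates_iteration[OF halts 0]) simp_all
  then show ?case by (simp add: map_bind_pmf)
next
  case (Suc r)
  let ?P = "descent M t 0 False (start M x)" and ?\<tau> = "4 * length x + 4 * t + 22"
  let ?K = "\<lambda>v. map_pmf (\<lambda>w. binval ga + v / 2 ^ L + w / 2 ^ L) (sum_pmf ?P (Suc r))"
  have "estimates A (conf Copy (string_tape x) tr (ga, int L + 1) (gn, int L + 1) ts)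
    (Suc r * ?\<tau> + ?\<tau> + 2 * card (ones ga) + 2 * card (ones gn)) (bind_pmf ?P ?K)"
  proof (rule estimates_iteration[OF halts Suc.prems])
    fix v ga' gn' and ts' :: "tape list"
    assume l: "accumulator L ga'" "binval ga' = binval ga + v / 2 ^ L" "counter L gn'"
      "binval gn' = 1 - real (Suc r) * 2 powi (- int L)" "length ts' = num_tapes M"
      "\<And>t. t \<in> set ts' \<Longrightarrow> fst t = (\<lambda>_. 0)"
    from Suc.IH[OF l(1,3-6)]
    show "estimates A (conf Copy (string_tape x) tr (ga', int L + 1) (gn', int L + 1) ts')
        (Suc r * ?\<tau> + 2 * card (ones ga') + 2 * card (ones gn')) (?K v)"
      unfolding l(2) .
  qed simp_all
  moreover have "bind_pmf ?P ?K = map_pmf (\<lambda>w. binval ga + w / 2 ^ L) (sum_pmf ?P (Suc (Suc r)))"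
    unfolding sum_pmf.simps(2)[of ?P "Suc r"] map_bind_pmf
    by (simp only: map_pmf_comp add_divide_distrib add.assoc)
  ultimately show ?case by (simp add: algebra_simps)
qed

section \<open>Setting up the tapes from \<open>\<xi>\<close>\<close>

lemma estimates_pad:
  assumes "i \<le> pad" "estimates A (conf Copy tx tr (ga(pa + int i := 3), pa + int i) (gn(pa + int i := 3), pa + int i) ts) T D"
  shows "estimates A (conf (Pad i) tx tr (ga, pa) (gn, pa) ts) (T + i + 1) D"
  using assms
proof (induction i arbitrary: pa)
  case 0
  then have "estimates A (conf (Pad 0) tx tr (ga, pa) (gn, pa) ts) (Suc T) D"
    by (auto simp del: fun_upd_apply intro!: estimates_delta)
  then show ?case by simp
next
  case (Suc i)
  have "estimates A (conf (Pad i) tx tr (ga, pa + 1) (gn, pa + 1) ts) (T + i + 1) D"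
    using Suc by (simp add: algebra_simps del: fun_upd_apply)
  then have "estimates A (conf (Pad (Suc i)) tx tr (ga, pa) (gn, pa) ts) (Suc (T + i + 1)) D"
    using Suc.prems(1) by (auto intro!: estimates_delta)
  then show ?case by simp
qed

text \<open>The heads of tapes 2 and 3 advance two cells for each digit of \<open>\<xi>\<close>;
  this doubling of \<open>m\<close> reflects the square in \<open>1 / \<xi>\<^sup>2\<close>.\<close>

lemma estimates_scan:
  assumes "\<And>i. 0 \<le> i \<Longrightarrow> i < int m \<Longrightarrow> R i \<noteq> 2" "R (int m) = 2" "j \<le> m"
    and "estimates A (conf (Pad pad) tx (R, int m) (ga, 2 * int m) (gn, 2 * int m) ts) T D"
  shows "estimates A (conf Scan tx (R, int j) (ga, 2 * int j) (gn, 2 * int j) ts) (T + 2 * (m - j) + 1) D"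
  using assms(3)
proof (induction j rule: inc_induct)
  case base
  have "estimates A (conf Scan tx (R, int m) (ga, 2 * int m) (gn, 2 * int m) ts) (Suc T) D"
    using assms(2,4) by (auto simp: fun_upd_idem intro!: estimates_delta)
  then show ?case by simp
next
  case (step j)
  let ?T = "T + 2 * (m - Suc j) + 1"
  have "estimates A (conf Scan2 tx (R, int j) (ga, 2 * int j + 1) (gn, 2 * int j + 1) ts) (Suc ?T) D"
    using step.IH by (auto simp: algebra_simps intro!: estimates_delta)
  moreover have "R (int j) \<noteq> 2" using assms(1)[of "int j"] step.hyps by simp
  ultimately have "estimates A (conf Scan tx (R, int j) (ga, 2 * int j) (gn, 2 * int j) ts) (Suc (Suc ?T)) D"
    by (auto intro!: estimates_delta)
  moreover have "Suc (Suc ?T) = T + 2 * (m - j) + 1" using step.hyps by simp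
  ultimately show ?case by (simp only:)
qed

lemma start_rand_sampling_machine:
  "start_rand A x \<xi> = conf Init (string_tape x) (fst (real_tape \<xi>), 0) (\<lambda>_. 0, 0) (\<lambda>_. 0, 0)
     (replicate (num_tapes M) blank_tape)"
  by (simp add: start_rand_def initial_def sampling_machine_def code.simps real_tape_def blank_tape_def
      numeral_eq_Suc)

lemma estimates_large:
  assumes "1 \<le> \<xi>"
  shows "estimates A (start_rand A x \<xi>) 1 (return_pmf 0)"
proof -
  have v: "tape_value (\<lambda>_. 0, 0) = 0" by (simp add: tape_value_def bit_sym_def)
  show ?thesis
  proof (cases "fst (real_tape \<xi>) 0 = 2")
    case True
    then have "succs A (start_rand A x \<xi>) = []"
      by (simp add: start_rand_sampling_machine succs_sampling_machine)
    from estimates_halted[OF this] show ?thesis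
      by (simp add: start_rand_sampling_machine estimate_def v)
  next
    case False
    with real_tape_large[OF assms] have "fst (real_tape \<xi>) (-1) \<noteq> 0" by simp
    then have "succs A (conf Check (string_tape x) (fst (real_tape \<xi>), -1) (\<lambda>_. 0, 0) ((\<lambda>_. 0)(0 := 3), 0)
        (replicate (num_tapes M) blank_tape)) = []"
      by (simp add: succs_sampling_machine)
    from estimates_halted[OF this, of 0]
    have "estimates A (conf Check (string_tape x) (fst (real_tape \<xi>), -1) (\<lambda>_. 0, 0) ((\<lambda>_. 0)(0 := 3), 0)
        (replicate (num_tapes M) blank_tape)) 0 (return_pmf 0)"
      by (simp add: estimate_def v)
    with False have "estimates A (start_rand A x \<xi>) (Suc 0) (return_pmf 0)"
      unfolding start_rand_sampling_machine
      by (intro estimates_delta[where s' = Check and ws = "(scan (string_tape x), Stay) #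
            (fst (real_tape \<xi>) 0, MoveL) # (0, Stay) # (3, Stay) # stay (map scan (replicate (num_tapes M) blank_tape))"])
        (simp_all add: fun_upd_idem del: map_replicate fun_upd_apply)
    then show ?thesis by simp
  qed
qed

text \<open>With \<open>L = 2 * m + c\<close>, the product \<open>2 ^ L * \<xi>\<^sup>2\<close> is
  \<open>2 ^ c\<close> times the square of \<open>\<xi> * 2 ^ m\<close>, which lies between 1 and 2.
  The lower bound gives the accuracy, the upper bound the running time.\<close>

lemma estimates_small:
  assumes "0 < \<xi>" "\<xi> < 1" "pad = Suc c" and halts: "halts_within M (start M x) t"
  obtains L where "2 ^ c \<le> 2 ^ L * \<xi>\<^sup>2" "2 ^ L * \<xi>\<^sup>2 \<le> 2 ^ (c + 2)"
    "estimates A (start_rand A x \<xi>) (2 ^ L * (4 * length x + 4 * t + 28))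
      (map_pmf (\<lambda>w. w / 2 ^ L) (sum_pmf (descent M t 0 False (start M x)) (2 ^ L)))"
proof -
  obtain m where m: "1 \<le> \<xi> * 2 ^ m" "\<xi> * 2 ^ m < 2" "fst (real_tape \<xi>) (-1) = 0"
    "\<And>i. 0 \<le> i \<Longrightarrow> i < int m \<Longrightarrow> fst (real_tape \<xi>) i \<noteq> 2" "fst (real_tape \<xi>) (int m) = 2" "0 < m"
    using real_tape_small[OF assms(1,2)] by blast
  let ?L = "2 * m + c" and ?R = "fst (real_tape \<xi>)" and ?ts = "replicate (num_tapes M) blank_tape"
  let ?D = "map_pmf (\<lambda>w. w / 2 ^ ?L) (sum_pmf (descent M t 0 False (start M x)) (2 ^ ?L))"
  define h where "h = int ?L + 1"
  let ?ga = "(\<lambda>_. 0)(h := 3) :: int \<Rightarrow> nat" and ?gn = "(\<lambda>_. 0)(0 := 3, h := 3) :: int \<Rightarrow> nat"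
  have eq: "2 ^ ?L * \<xi>\<^sup>2 = 2 ^ c * (\<xi> * 2 ^ m)\<^sup>2"
    by (simp add: power_add power_mult_distrib power_mult power2_eq_square mult_2 algebra_simps)
  have "1 \<le> (\<xi> * 2 ^ m)\<^sup>2" using m(1) by (simp add: one_le_power)
  then have 1: "2 ^ c \<le> 2 ^ ?L * \<xi>\<^sup>2" unfolding eq by simp
  have "(\<xi> * 2 ^ m)\<^sup>2 \<le> 2\<^sup>2" using m(1,2) by (intro power_mono) auto
  then have "2 ^ c * (\<xi> * 2 ^ m)\<^sup>2 \<le> 2 ^ c * 2\<^sup>2" by (rule mult_left_mono) simp
  then have 2: "2 ^ ?L * \<xi>\<^sup>2 \<le> 2 ^ (c + 2)" by (simp only: eq power_add[of 2 c 2])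
  have ones0: "ones ?ga = {}" "ones ?gn = {}" by (auto simp: ones_def)
  have acc: "accumulator ?L ?ga" using ones0 by (auto simp: accumulator_def h_def)
  have ctr: "counter ?L ?gn" using ones0 by (auto simp: counter_def h_def)
  \<comment> \<open>The empty counter has the value 0, which says that all \<open>2 ^ L\<close>
    samples are outstanding.\<close>
  have val: "binval ?gn = 1 - real (Suc (2 ^ ?L - 1)) * 2 powi (- int ?L)"
    unfolding binval_def ones0 by (simp add: power_int_minus del: of_nat_add of_nat_mult)
  let ?T0 = "2 ^ ?L * (4 * length x + 4 * t + 22)"
  have "estimates A (conf Copy (string_tape x) (?R, int m) (?ga, h) (?gn, h) ?ts) ?T0 ?D"
    using estimates_loop[OF halts acc ctr val, of ?ts "(?R, int m)", folded h_def]
    by (simp add: ones0 binval_def blank_tape_def del: fun_upd_apply)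
  moreover have "2 * int m + int pad = h" by (simp add: h_def assms(3))
  ultimately have "estimates A (conf (Pad pad) (string_tape x) (?R, int m) (\<lambda>_. 0, 2 * int m) ((\<lambda>_. 0)(0 := 3), 2 * int m) ?ts)
      (?T0 + pad + 1) ?D"
    by (intro estimates_pad) simp_all
  from estimates_scan[OF m(4,5) _ this, of 0]
  have "estimates A (conf Scan (string_tape x) (?R, 0) (\<lambda>_. 0, 0) ((\<lambda>_. 0)(0 := 3), 0) ?ts)
      (?T0 + pad + 1 + 2 * m + 1) ?D" by simp
  then have "estimates A (conf Check (string_tape x) (?R, -1) (\<lambda>_. 0, 0) ((\<lambda>_. 0)(0 := 3), 0) ?ts)
      (Suc (?T0 + pad + 1 + 2 * m + 1)) ?D"
    using m(3)
    by (intro estimates_delta[where s' = Scan and ws = "(scan (string_tape x), Stay) #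
          (0, MoveR) # (0, Stay) # (3, Stay) # stay (map scan ?ts)"])
      (simp_all add: fun_upd_idem del: map_replicate)
  moreover have "?R 0 \<noteq> 2" using m(4)[of 0] m(6) by simp
  ultimately have e: "estimates A (start_rand A x \<xi>) (Suc (Suc (?T0 + pad + 1 + 2 * m + 1))) ?D"
    unfolding start_rand_sampling_machine
    by (intro estimates_delta[where s' = Check and ws = "(scan (string_tape x), Stay) #
          (?R 0, MoveL) # (0, Stay) # (3, Stay) # stay (map scan ?ts)"])
      (simp_all add: fun_upd_idem del: map_replicate fun_upd_apply)
  \<comment> \<open>The setup takes time linear in \<open>L\<close> and is absorbed into the loop by
    raising the constant 22 to 28.\<close>
  have "?L < 2 ^ ?L" by (rule less_exp)
  then have "5 + (c + 2 * m) \<le> 6 * 2 ^ ?L" by linarith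
  then have "Suc (Suc (?T0 + pad + 1 + 2 * m + 1)) \<le> 2 ^ ?L * (4 * length x + 4 * t + 28)"
    by (simp add: assms(3) distrib_left)
  from estimates_mono[OF e this] 1 2 show thesis by (intro that[of ?L]) auto
qed

end

theorem theorem1:
  fixes f :: "bool list \<Rightarrow> nat" and M :: machine and \<delta> :: real
  assumes "f \<in> TotP"
    and "binary_machine M" and "TotP_witness M f"
    and "0 < \<delta>" and "\<delta> < 1"
  shows "\<exists>A (q :: nat poly). randomized_algorithm A \<and>
    (\<forall>\<xi> x. 0 < (\<xi> :: real) \<longrightarrow>
      (\<exists>T. real T \<le> max 1 (1 / \<xi>\<^sup>2) * real (poly q (length x)) \<and>
        halts_within A (start_rand A x \<xi>) T \<and>
        measure_pmf.prob (run_pmf A T (start_rand A x \<xi>))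
          {c. (let N = 2 ^ nondet_bits M x; est = estimate c; p = real (f x) / N; p_est = est / N in
                 real (f x) - \<xi> * N \<le> est \<and> est \<le> real (f x) + \<xi> * N \<and>
                 p - \<xi> \<le> p_est \<and> p_est \<le> p + \<xi>)}
          \<ge> 1 - \<delta>))"
proof -
  have wf: "wf_machine M" and paths: "\<And>x. card (computation_paths M (start M x)) = f x + 1"
    using assms(3) by (auto simp: TotP_witness_def nptm_def)
  obtain qM :: "nat poly" where qM: "\<And>x. halts_within M (start M x) (poly qM (length x))"
    using assms(3) by (auto simp: TotP_witness_def nptm_def)
  \<comment> \<open>Since \<open>2 ^ L * \<xi>\<^sup>2\<close> is at least \<open>2 ^ c\<close>,
    this choice makes the Chebyshev failure bound smaller than \<open>\<delta>\<close>.\<close>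
  obtain c where c: "1 / \<delta> < 2 ^ c" using real_arch_pow[of 2 "1 / \<delta>"] by auto
  interpret sampler M "Suc c" by unfold_locales (rule wf, rule assms(2))
  \<comment> \<open>The factor \<open>2 ^ (c + 2)\<close> is the upper bound for
    \<open>2 ^ L * \<xi>\<^sup>2\<close>; the remaining factor is the time per sample, setup
    included.\<close>
  define q where "q = smult (2 ^ (c + 2)) ([:28, 4:] + smult 4 qM)"
  have q: "poly q n = 2 ^ (c + 2) * (4 * n + 4 * poly qM n + 28)" for n
    by (simp add: q_def algebra_simps)
  have "\<exists>T. real T \<le> max 1 (1 / \<xi>\<^sup>2) * real (poly q (length x)) \<and>
        halts_within A (start_rand A x \<xi>) T \<and>
        measure_pmf.prob (run_pmf A T (start_rand A x \<xi>))
          {c. (let N = 2 ^ nondet_bits M x; est = estimate c; p = real (f x) / N; p_est = est / N in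
                 real (f x) - \<xi> * N \<le> est \<and> est \<le> real (f x) + \<xi> * N \<and>
                 p - \<xi> \<le> p_est \<and> p_est \<le> p + \<xi>)}
          \<ge> 1 - \<delta>" (is "\<exists>T. _ \<and> _ \<and> measure_pmf.prob _ ?G \<ge> _") if pos: "0 < \<xi>" for \<xi> :: real and x
  proof -
    define N :: real where "N = 2 ^ nondet_bits M x"
    let ?n = "length x"
    let ?P = "descent M (poly qM ?n) 0 False (start M x)"
    have N: "0 < N" by (simp add: N_def)
    \<comment> \<open>The conditions on \<open>p\<close> and \<open>p_est\<close> are those on
      \<open>f x\<close> and the estimate divided by \<open>N\<close>.\<close>
    have G: "?G = estimate -` {e. \<bar>e - f x\<bar> \<le> \<xi> * N}"
      using N by (auto simp: Let_def N_def[symmetric] abs_le_iff field_simps)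
    have prob: "measure_pmf.prob (run_pmf A T (start_rand A x \<xi>)) ?G = measure_pmf.prob D {e. \<bar>e - f x\<bar> \<le> \<xi> * N}"
      if "estimates A (start_rand A x \<xi>) T D" for T D
      using that unfolding G estimates_def by (metis measure_map_pmf)
    have fin: "finite (set_pmf ?P)" by (rule finite_set_descent)
    have bnd: "0 \<le> v \<and> v \<le> N" if "v \<in> set_pmf ?P" for v
    proof -
      from descent_le_branchings[OF wf assms(2) qM valid_start[OF wf] that] obtain ks
        where ks: "0 \<le> v" "ks \<in> computation_paths M (start M x)" "v \<le> 2 ^ branchings M (start M x) ks" by auto
      have "branchings M (start M x) ks \<le> nondet_bits M x"
        unfolding nondet_bits_def using ks(2) finite_computation_paths[OF qM] by (intro Max_ge) auto
      then have "(2::real) ^ branchings M (start M x) ks \<le> N" unfolding N_def by (intro power_increasing) auto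
      with ks show ?thesis by linarith
    qed
    have mean: "measure_pmf.expectation ?P (\<lambda>v. v) = f x"
      using expectation_descent[OF wf assms(2) qM valid_start[OF wf]] by (simp add: paths)
    \<comment> \<open>\<open>f x\<close> is the mean of scores that are at most \<open>N\<close>;
      this is what makes the answer 0 correct for \<open>1 \<le> \<xi>\<close>.\<close>
    have fN: "real (f x) \<le> N"
      unfolding mean[symmetric] using bnd
      by (intro measure_pmf.integral_le_const integrable_measure_pmf_finite fin AE_pmfI) auto
    show ?thesis
    proof (cases "1 \<le> \<xi>")
      case True
      have e: "estimates A (start_rand A x \<xi>) 1 (return_pmf 0)" by (rule estimates_large[OF True])
      have "real (f x) \<le> \<xi> * N" using fN True N mult_right_mono[of 1 \<xi> N] by linarith
      then have "measure_pmf.prob (run_pmf A 1 (start_rand A x \<xi>)) ?G = 1"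
        unfolding prob[OF e] by simp
      moreover have "1 * 1 \<le> max 1 (1 / \<xi>\<^sup>2) * real (poly q ?n)"
      proof (rule mult_mono)
        have "1 \<le> poly q ?n" unfolding q by (simp add: Suc_le_eq)
        then show "1 \<le> real (poly q ?n)" by linarith
      qed auto
      ultimately show ?thesis using e assms(4) unfolding estimates_def by (intro exI[of _ 1]) auto
    next
      case False
      then have "\<xi> < 1" by simp
      obtain L where L: "2 ^ c \<le> 2 ^ L * \<xi>\<^sup>2" "2 ^ L * \<xi>\<^sup>2 \<le> 2 ^ (c + 2)"
        and e: "estimates A (start_rand A x \<xi>) (2 ^ L * (4 * ?n + 4 * poly qM ?n + 28))
          (map_pmf (\<lambda>w. w / 2 ^ L) (sum_pmf ?P (2 ^ L)))"
        by (rule estimates_small[OF pos \<open>\<xi> < 1\<close> refl qM])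
      let ?T = "2 ^ L * (4 * ?n + 4 * poly qM ?n + 28)"
      have "2 ^ L \<le> 1 / \<xi>\<^sup>2 * 2 ^ (c + 2)" using L(2) that by (simp add: field_simps)
      also have "\<dots> \<le> max 1 (1 / \<xi>\<^sup>2) * 2 ^ (c + 2)" by (intro mult_right_mono) auto
      finally have "real (2 ^ L) * real (4 * ?n + 4 * poly qM ?n + 28) \<le>
          max 1 (1 / \<xi>\<^sup>2) * 2 ^ (c + 2) * real (4 * ?n + 4 * poly qM ?n + 28)"
        by (intro mult_right_mono) auto
      then have time: "real ?T \<le> max 1 (1 / \<xi>\<^sup>2) * real (poly q ?n)"
        unfolding q by (simp only: of_nat_mult of_nat_power of_nat_numeral mult.assoc)
      have "1 - \<delta> \<le> 1 - 1 / (real (2 ^ L) * \<xi>\<^sup>2)"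
      proof -
        have "1 / \<delta> < real (2 ^ L) * \<xi>\<^sup>2" using c L(1) by simp
        then have "1 / (real (2 ^ L) * \<xi>\<^sup>2) \<le> \<delta>"
          using assms(4) that by (simp add: field_simps)
        then show ?thesis by simp
      qed
      also have "\<dots> \<le> measure_pmf.prob (sum_pmf ?P (2 ^ L))
          {w. \<bar>w / real (2 ^ L) - measure_pmf.expectation ?P (\<lambda>v. v)\<bar> \<le> \<xi> * N}"
        by (rule chebyshev_sum_pmf[OF fin bnd]) (use that N in auto)
      also have "\<dots> = measure_pmf.prob (run_pmf A ?T (start_rand A x \<xi>)) ?G"
        unfolding prob[OF e] mean by (simp add: vimage_def)
      finally show ?thesis using time e unfolding estimates_def by (intro exI[of _ ?T]) simp
    qed
  qed
  then show ?thesis using randomized_algorithm_sampling_machine by blast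
qed

end
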